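(* Let $n,r,k$ and $t$ be positive integers with $n\ge t+2\ge 4$, $n\ge r\ge t+1$ and $k\ge\max\{2,g(n,r,t)\}$. Suppose that $\mathcal{F}$ is a largest (maximum-sized) non-trivial $t$-intersecting subfamily of $\mathcal{L}_{n,r,k}$. (i) If $\min\{r+1,n\}\le 2t+2$, then $\mathcal{F}\cong\mathcal{H}_1(n,r,k,t+2,t)$. (ii) If $\min\{r+1,n\}>2t+2$, then $\mathcal{F}\cong\mathcal{H}_1(n,r,k,\min\{r+1,n\},t)$.
   Context: Write $[n]=\{1,\dots,n\}$. For $k\ge 2$ and $1\le r\le n$, a $k$-signed $r$-set on $[n]$ is a set $\{(x_1,y_1),\dots,(x_r,y_r)\}$ with $x_1,\dots,x_r$ distinct elements of $[n]$ and $y_1,\dots,y_r\in[k]$; $\mathcal{L}_{n,r,k}$ denotes the set of all of these. A family $\mathcal{F}\subset\mathcal{L}_{n,r,k}$ is $t$-intersecting if $|F\cap F'|\ge t$ for all $F,F'\in\mathcal{F}$. It is trivial if there is a fixed $k$-signed $t$-set contained in every member of $\mathcal{F}$, and non-trivial otherwise. For $\mathcal{F},\mathcal{G}\subset\mathcal{L}_{n,r,k}$, $\mathcal{F}\cong\mathcal{G}$ means that there is a bijection $\sigma:[n]\times[k]\to[n]\times[k]$ with $\mathcal{G}=\{\sigma(F):F\in\mathcal{F}\}$. For $d\in[n]$ let $M_d=\{(1,1),(2,1),\dots,(d,1)\}$. For positive integers with $k\ge 2$, $t+1\le r\le n$ and $t+2\le\ell\le\min\{r+1,n\}$, $\mathcal{H}_1(n,r,k,\ell,t)$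 is the set of all $F\in\mathcal{L}_{n,r,k}$ such that either $M_t\subset F$ and $|F\cap M_\ell|\ge t+1$, or $M_t\not\subset F$ and $|F\cap M_\ell|=\ell-1$. Finally, $$g(n,r,t)=\frac{(r-t+3)(r-t-1)}{n-t-1}\cdot\max\left\{\binom{t+2}{2},\frac{r-t+1}{2}\right\}.$$ *)

theory Defs
  imports Complex_Main
begin

text \<open>Indices and signs start at 1, and \<open>[n] \<times> [k]\<close> is \<open>{1..n} \<times> {1..k}\<close>.\<close>

definition signed_sets :: "nat \<Rightarrow> nat \<Rightarrow> nat \<Rightarrow> (nat \<times> nat) set set" where
  "signed_sets n r k =
     {(\<lambda>i. (x i, y i)) ` {1..r} | x y.
        inj_on x {1..r} \<and> x ` {1..r} \<subseteq> {1..n} \<and> y ` {1..r} \<subseteq> {1..k}}"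

lemma signed_setsI:
  assumes "F = (\<lambda>i. (x i, y i)) ` {1..r}" "inj_on x {1..r}"
    "x ` {1..r} \<subseteq> {1..n}" "y ` {1..r} \<subseteq> {1..k}"
  shows "F \<in> signed_sets n r k"
  unfolding signed_sets_def mem_Collect_eq using assms by (intro exI conjI)

lemma signed_setsE:
  assumes "F \<in> signed_sets n r k"
  obtains x y where "F = (\<lambda>i. (x i, y i)) ` {1..r}" "inj_on x {1..r}"
    "x ` {1..r} \<subseteq> {1..n}" "y ` {1..r} \<subseteq> {1..k}"
  using assms unfolding signed_sets_def mem_Collect_eq by (elim exE conjE)

lemma signed_sets_altdef:
  "signed_sets n r k = {F. F \<subseteq> {1..n} \<times> {1..k} \<and> inj_on fst F \<and> card F = r}"
proof (intro equalityI subsetI)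
  fix F assume "F \<in> signed_sets n r k"
  then obtain x y where F: "F = (\<lambda>i. (x i, y i)) ` {1..r}"
    and x: "inj_on x {1..r}" "x ` {1..r} \<subseteq> {1..n}" and y: "y ` {1..r} \<subseteq> {1..k}"
    by (rule signed_setsE)
  have "inj_on (\<lambda>i. (x i, y i)) {1..r}" using x(1) by (auto intro!: inj_onI dest: inj_onD)
  then have "card F = r" by (simp add: F card_image)
  moreover have "inj_on fst F" unfolding F by (auto intro!: inj_onI simp: inj_on_eq_iff [OF x(1)])
  moreover have "F \<subseteq> {1..n} \<times> {1..k}" using x(2) y by (simp add: F image_subset_iff)
  ultimately show "F \<in> {F. F \<subseteq> {1..n} \<times> {1..k} \<and> inj_on fst F \<and> card F = r}"
    by (intro CollectI conjI)
next
  fix F assume "F \<in> {F. F \<subseteq> {1..n} \<times> {1..k} \<and> inj_on fst F \<and> card F = r}"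
  then have F: "F \<subseteq> {1..n} \<times> {1..k}" "inj_on fst F" "card F = r" by auto
  have "finite F" using F(1) by (rule finite_subset) simp
  then obtain h where h: "bij_betw h {1..r} F"
    using ex_bij_betw_nat_finite_1 [of F] F(3) by auto
  then have hF: "h ` {1..r} = F" and "inj_on h {1..r}" by (simp_all add: bij_betw_def)
  then have "inj_on (fst \<circ> h) {1..r}" using F(2) by (simp add: comp_inj_on)
  moreover have "(fst \<circ> h) ` {1..r} \<subseteq> {1..n}" "(snd \<circ> h) ` {1..r} \<subseteq> {1..k}"
    using F(1) by (auto simp: hF [symmetric])
  moreover have "F = (\<lambda>i. ((fst \<circ> h) i, (snd \<circ> h) i)) ` {1..r}" using hF by simp
  ultimately show "F \<in> signed_sets n r k" by (intro signed_setsI)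
qed

definition t_intersecting :: "nat \<Rightarrow> 'a set set \<Rightarrow> bool" where
  "t_intersecting t \<F> \<longleftrightarrow> (\<forall>F\<in>\<F>. \<forall>F'\<in>\<F>. card (F \<inter> F') \<ge> t)"

definition trivial_family :: "nat \<Rightarrow> nat \<Rightarrow> nat \<Rightarrow> (nat \<times> nat) set set \<Rightarrow> bool" where
  "trivial_family n k t \<F> \<longleftrightarrow> (\<exists>T\<in>signed_sets n t k. \<forall>F\<in>\<F>. T \<subseteq> F)"

definition nontrivial_t_intersecting ::
  "nat \<Rightarrow> nat \<Rightarrow> nat \<Rightarrow> nat \<Rightarrow> (nat \<times> nat) set set \<Rightarrow> bool" where
  "nontrivial_t_intersecting n r k t \<F> \<longleftrightarrow>
     \<F> \<subseteq> signed_sets n r k \<and> t_intersecting t \<F> \<and> \<not> trivial_family n k t \<F>"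

definition largest_nontrivial_t_intersecting ::
  "nat \<Rightarrow> nat \<Rightarrow> nat \<Rightarrow> nat \<Rightarrow> (nat \<times> nat) set set \<Rightarrow> bool" where
  "largest_nontrivial_t_intersecting n r k t \<F> \<longleftrightarrow>
     nontrivial_t_intersecting n r k t \<F> \<and>
     (\<forall>\<G>. nontrivial_t_intersecting n r k t \<G> \<longrightarrow> card \<G> \<le> card \<F>)"

text \<open>The bijection \<open>\<sigma>\<close> is arbitrary: it need not preserve the fibres of the first projection.\<close>

definition family_iso ::
  "nat \<Rightarrow> nat \<Rightarrow> (nat \<times> nat) set set \<Rightarrow> (nat \<times> nat) set set \<Rightarrow> bool" where
  "family_iso n k \<F> \<G> \<longleftrightarrow>
     (\<exists>\<sigma>. bij_betw \<sigma> ({1..n} \<times> {1..k}) ({1..n} \<times> {1..k}) \<and> \<G> = {\<sigma> ` F | F. F \<in> \<F>})"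

definition M :: "nat \<Rightarrow> (nat \<times> nat) set" where
  "M d = {(i, 1) | i. i \<in> {1..d}}"

definition H1 :: "nat \<Rightarrow> nat \<Rightarrow> nat \<Rightarrow> nat \<Rightarrow> nat \<Rightarrow> (nat \<times> nat) set set" where
  "H1 n r k l t =
     {F \<in> signed_sets n r k.
        (M t \<subseteq> F \<and> card (F \<inter> M l) \<ge> t + 1) \<or>
        (\<not> M t \<subseteq> F \<and> card (F \<inter> M l) = l - 1)}"

definition g :: "nat \<Rightarrow> nat \<Rightarrow> nat \<Rightarrow> real" where
  "g n r t =
     ((real r - real t + 3) * (real r - real t - 1)) / (real n - real t - 1) *
     max (real ((t + 2) choose 2)) ((real r - real t + 1) / 2)"

end

theory Submission
  imports Defs "HOL-Combinatorics.Transposition"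
begin

text \<open>
  Write \<open>v = min (r + 1) n - t\<close> and let \<open>N s\<close> be the number of signed \<open>r\<close>-sets containing a
  given signed \<open>s\<close>-set; it depends only on \<open>s\<close> (\<open>card_star\<close>), because coordinates can be permuted
  and signs can be permuted separately at each coordinate. The lower bound on \<open>k\<close> enters only as
  \<open>(v + 2) * c * N (s + 1) \<le> N s\<close> and \<open>(v + 2) * v * N (s + 1) \<le> 2 * N s\<close> for \<open>s \<ge> t + 1\<close>, with
  \<open>c = (t + 2) choose 2\<close> (\<open>star_size_ratio\<close>).

  The two candidate families satisfy
  \<open>card (H1 n r k (t + 2) t) \<ge> (t + 2) * N (t + 1) - (t + 1) * N (t + 2)\<close> and
  \<open>card (H1 n r k (t + v) t) \<ge> v * N (t + 1) - (v choose 2) * N (t + 2)\<close>. The first bound is the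
  relevant one for \<open>v \<le> t + 2\<close>, the second for \<open>v > t + 2\<close>.

  A \<open>t\<close>-cover of the family \<open>\<F>\<close> is a signed set meeting each member in at least \<open>t\<close> points. If a
  signed \<open>s\<close>-set \<open>S\<close> with \<open>s \<ge> t\<close> is not a \<open>t\<close>-cover, then the members of \<open>\<F>\<close> containing \<open>S\<close> all
  hit one set of at most \<open>v\<close> points outside \<open>S\<close> (\<open>branching_set\<close>). Let \<open>\<F>\<close> be a largest non-trivial
  \<open>t\<close>-intersecting family; it has no cover of size at most \<open>t\<close>.

  If \<open>\<F>\<close> has no cover of size \<open>t + 1\<close>, branching down from the \<open>t\<close>-subsets of a smallest cover gives
  \<open>card \<F> \<le> c * v^2 * N (t + 2)\<close>, which is too small. Otherwise the covers of size \<open>t + 1\<close> pairwise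
  meet in at least \<open>t\<close> points, because by maximality every \<open>r\<close>-set above one of them belongs to
  \<open>\<F>\<close> and \<open>k \<ge> 2\<close> leaves room for extensions that meet only where they must
  (\<open>covers_intersect\<close>). Hence these covers either lie in a common signed \<open>(t + 2)\<close>-set \<open>Z\<close>, no
  \<open>t\<close>-set being common to them all, or they contain a common \<open>t\<close>-set \<open>E\<close>.

  In the first case every member of \<open>\<F>\<close> meets \<open>Z\<close> in at least \<open>t + 1\<close> points, so \<open>\<F>\<close> is a copy of
  \<open>H1 n r k (t + 2) t\<close> (\<open>covers_triangle\<close>); this is too small if \<open>v > t + 2\<close>. In the second case let the
  covers be \<open>insert z E\<close> with \<open>z\<close> in a set \<open>Y\<close> of \<open>m\<close> points. The members not containing \<open>E\<close> contain
  \<open>Y\<close> and miss one point of \<open>E\<close>, so \<open>m \<le> v\<close> and branching bounds the number of these members and of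
  those that contain \<open>E\<close> but avoid \<open>Y\<close>. The resulting bound is below the benchmark unless
  \<open>m = v > t + 2\<close>. Then no member contains \<open>E\<close> and avoids \<open>Y\<close>, and \<open>\<F>\<close> is a copy of
  \<open>H1 n r k (t + v) t\<close>.
\<close>

section \<open>Signed sets\<close>

lemma signed_setsD:
  assumes "F \<in> signed_sets n r k"
  shows "F \<subseteq> {1..n} \<times> {1..k}" "inj_on fst F" "card F = r" "finite F"
proof -
  show *: "F \<subseteq> {1..n} \<times> {1..k}" "inj_on fst F" "card F = r"
    using assms by (auto simp: signed_sets_altdef)
  show "finite F" using *(1) by (rule finite_subset) simp
qed

lemma signed_sets_subset:
  assumes "F \<in> signed_sets n r k" "S \<subseteq> F"
  shows "S \<in> signed_sets n (card S) k"
  using signed_setsD [OF assms(1)] assms(2)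
  by (auto simp: signed_sets_altdef intro: inj_on_subset)

lemma finite_signed_sets: "finite (signed_sets n r k)"
  by (rule finite_subset [of _ "Pow ({1..n} \<times> {1..k})"]) (auto simp: signed_sets_altdef)

lemma signed_sets_card_le:
  assumes "S \<in> signed_sets n s k"
  shows "s \<le> n"
proof -
  note S = signed_setsD [OF assms]
  have "card (fst ` S) \<le> card {1..n}" using S(1) by (intro card_mono) auto
  then show ?thesis using S by (simp add: card_image)
qed

lemma signed_sets_insert:
  assumes "S \<in> signed_sets n s k" "x \<in> {1..n}" "y \<in> {1..k}" "x \<notin> fst ` S"
  shows "insert (x, y) S \<in> signed_sets n (Suc s) k"
proof -
  note S = signed_setsD [OF assms(1)]
  have "(x, y) \<notin> S" using assms(4) by force
  then show ?thesis using S assms by (auto simp: signed_sets_altdef)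
qed

lemma fst_notin_if_insert_signed:
  assumes "insert w S \<in> signed_sets n s k" "w \<notin> S"
  shows "fst w \<notin> fst ` S"
  using signed_setsD(2) [OF assms(1)] assms(2) by auto

lemma M_signed: "d \<le> n \<Longrightarrow> 0 < k \<Longrightarrow> M d \<in> signed_sets n d k"
proof -
  assume "d \<le> n" "0 < k"
  have "M d = (\<lambda>i. (i, 1)) ` {1..d}" by (auto simp: M_def)
  then have "card (M d) = d" by (simp add: card_image inj_on_def)
  then show ?thesis using \<open>d \<le> n\<close> \<open>0 < k\<close> by (auto simp: signed_sets_altdef M_def inj_on_def)
qed

lemma finite_M [simp]: "finite (M d)" and card_M [simp]: "card (M d) = d"
  using signed_setsD [OF M_signed [of d d 1]] by auto

lemma M_mono: "d \<le> e \<Longrightarrow> M d \<subseteq> M e"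
  by (auto simp: M_def)

text \<open>Any signed set extends to an \<open>r\<close>-set that meets a prescribed signed set \<open>B\<close> only inside
  itself: at each new coordinate at most one sign is used by \<open>B\<close>, and there are at least two.\<close>

lemma signed_sets_extend:
  assumes S: "S \<in> signed_sets n s k" and "s \<le> r" "r \<le> n" "2 \<le> k" and B: "inj_on fst B"
  shows "\<exists>F\<in>signed_sets n r k. S \<subseteq> F \<and> F \<inter> B \<subseteq> S"
  using \<open>s \<le> r\<close>
proof (induction r rule: dec_induct)
  case base
  then show ?case using S by auto
next
  case (step r')
  then obtain F where F: "F \<in> signed_sets n r' k" "S \<subseteq> F" "F \<inter> B \<subseteq> S" by auto
  note FD = signed_setsD [OF F(1)]
  have "card (fst ` F) < card {1..n}"
    using FD step.hyps \<open>r \<le> n\<close> by (simp add: card_image)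
  then have "\<not> {1..n} \<subseteq> fst ` F"
    using FD(4) by (meson card_mono finite_imageI not_le)
  then obtain x where x: "x \<in> {1..n}" "x \<notin> fst ` F" by blast
  have "(x, 1) \<notin> B \<or> (x, 2) \<notin> B" using B by (force simp: inj_on_def)
  moreover have "1 \<in> {1..k}" "2 \<in> {1..k}" using \<open>2 \<le> k\<close> by auto
  ultimately obtain y where y: "y \<in> {1..k}" "(x, y) \<notin> B" by blast
  have "insert (x, y) F \<in> signed_sets n (Suc r') k"
    using F(1) x y by (intro signed_sets_insert) auto
  then show ?case using F y by blast
qed

section \<open>Symmetries and counting\<close>

text \<open>The permutations of \<open>[n] \<times> [k]\<close> that permute the fibres of the first projection; they act on
  the signed sets of each size.\<close>

definition signed_symmetry :: "nat \<Rightarrow> nat \<Rightarrow> (nat \<times> nat \<Rightarrow> nat \<times> nat) \<Rightarrow> bool" where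
  "signed_symmetry n k \<sigma> \<longleftrightarrow> bij_betw \<sigma> ({1..n} \<times> {1..k}) ({1..n} \<times> {1..k}) \<and>
     (\<forall>p\<in>{1..n} \<times> {1..k}. \<forall>q\<in>{1..n} \<times> {1..k}. fst (\<sigma> p) = fst (\<sigma> q) \<longleftrightarrow> fst p = fst q)"

lemma signed_symmetry_bij:
  assumes "signed_symmetry n k \<sigma>"
  shows "bij_betw (image \<sigma>) (signed_sets n r k) (signed_sets n r k)"
proof -
  let ?B = "{1..n} \<times> {1..k}"
  have \<sigma>: "bij_betw \<sigma> ?B ?B" and
    fst_iff: "\<And>p q. p \<in> ?B \<Longrightarrow> q \<in> ?B \<Longrightarrow> fst (\<sigma> p) = fst (\<sigma> q) \<longleftrightarrow> fst p = fst q"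
    using assms unfolding signed_symmetry_def by blast+
  have inj: "inj_on \<sigma> ?B" using \<sigma> by (simp add: bij_betw_def)
  have pow: "bij_betw (image \<sigma>) (Pow ?B) (Pow ?B)" using \<sigma> by (rule bij_betw_Pow)
  have iff: "\<sigma> ` F \<in> signed_sets n r k \<longleftrightarrow> F \<in> signed_sets n r k" if "F \<subseteq> ?B" for F
  proof -
    have "card (\<sigma> ` F) = card F" using inj that by (simp add: card_image inj_on_subset)
    moreover have "\<sigma> ` F \<subseteq> ?B" using \<sigma> that by (auto simp: bij_betw_def)
    moreover have "inj_on fst (\<sigma> ` F) \<longleftrightarrow> inj_on fst F"
    proof
      assume *: "inj_on fst (\<sigma> ` F)"
      show "inj_on fst F"
      proof (rule inj_onI)
        fix p q assume pq: "p \<in> F" "q \<in> F" "fst p = fst q"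
        then have "\<sigma> p = \<sigma> q"
          using that fst_iff [of p q] by (intro inj_onD [OF *]) auto
        then show "p = q" using inj pq that by (auto dest: inj_onD)
      qed
    next
      assume *: "inj_on fst F"
      show "inj_on fst (\<sigma> ` F)"
      proof (rule inj_onI)
        fix p' q' assume "p' \<in> \<sigma> ` F" "q' \<in> \<sigma> ` F" and eq: "fst p' = fst q'"
        then obtain p q where pq: "p \<in> F" "p' = \<sigma> p" "q \<in> F" "q' = \<sigma> q" by auto
        then have "p = q" using eq that fst_iff [of p q] by (intro inj_onD [OF *]) auto
        then show "p' = q'" using pq by simp
      qed
    qed
    ultimately show ?thesis using that by (auto simp: signed_sets_altdef)
  qed
  have sub: "signed_sets n r k \<subseteq> Pow ?B" by (auto simp: signed_sets_altdef)
  have "image \<sigma> ` signed_sets n r k = signed_sets n r k"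
  proof
    show "image \<sigma> ` signed_sets n r k \<subseteq> signed_sets n r k" using iff sub by blast
    show "signed_sets n r k \<subseteq> image \<sigma> ` signed_sets n r k"
    proof
      fix G assume G: "G \<in> signed_sets n r k"
      then have "G \<in> image \<sigma> ` Pow ?B" using pow sub by (auto simp: bij_betw_def)
      then obtain F where "F \<subseteq> ?B" "G = \<sigma> ` F" by auto
      then show "G \<in> image \<sigma> ` signed_sets n r k" using iff G by auto
    qed
  qed
  then show ?thesis using pow sub by (auto simp: bij_betw_def intro: inj_on_subset)
qed

text \<open>Permuting the coordinates, and swapping at each coordinate of \<open>Z\<close> the sign used there with
  the sign 1, carries \<open>E \<subseteq> Z\<close> to \<open>M d \<subseteq> M l\<close>.\<close>

lemma signed_symmetry_exists:
  assumes Z: "Z \<in> signed_sets n l k" and "E \<subseteq> Z" "card E = d"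
  obtains \<sigma> where "signed_symmetry n k \<sigma>" "\<sigma> ` E = M d" "\<sigma> ` Z = M l"
proof -
  note ZD = signed_setsD [OF Z]
  have "l \<le> n" using Z by (rule signed_sets_card_le)
  have finE: "finite E" using ZD(4) \<open>E \<subseteq> Z\<close> finite_subset by blast
  have "d \<le> l" using assms ZD card_mono by metis
  have injE: "inj_on fst E" and injZE: "inj_on fst (Z - E)"
    using ZD(2) \<open>E \<subseteq> Z\<close> by (auto intro: inj_on_subset)
  have cZE: "card (Z - E) = l - d" using assms ZD finE by (simp add: card_Diff_subset)
  have "card (fst ` Z) = l" using ZD by (simp add: card_image)
  then have "card ({1..n} - fst ` Z) = n - l" using ZD by (subst card_Diff_subset) auto
  then have "\<exists>h. bij_betw h ({1..n} - fst ` Z) {Suc l..n}"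
    by (intro finite_same_card_bij) auto
  then obtain h3 where h3: "bij_betw h3 ({1..n} - fst ` Z) {Suc l..n}" ..
  have "\<exists>h. bij_betw h (fst ` E) {1..d}"
    using finE injE assms(3) by (intro finite_same_card_bij) (auto simp: card_image)
  then obtain h1 where h1: "bij_betw h1 (fst ` E) {1..d}" ..
  have "\<exists>h. bij_betw h (fst ` (Z - E)) {Suc d..l}"
    using ZD(4) injZE cZE by (intro finite_same_card_bij) (auto simp: card_image)
  then obtain h2 where h2: "bij_betw h2 (fst ` (Z - E)) {Suc d..l}" ..
  have disj: "fst ` E \<inter> fst ` (Z - E) = {}"
  proof -
    have "fst ` E \<inter> fst ` (Z - E) = fst ` (E \<inter> (Z - E))"
      using ZD(2) \<open>E \<subseteq> Z\<close> by (intro inj_on_image_Int [symmetric]) auto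
    then show ?thesis by simp
  qed
  define p where "p x = (if x \<in> fst ` E then h1 x else if x \<in> fst ` Z then h2 x else h3 x)" for x
  have p1: "bij_betw p (fst ` E) {1..d}"
    using h1 by (rule bij_betw_cong [THEN iffD1, rotated]) (simp add: p_def)
  have p2: "bij_betw p (fst ` (Z - E)) {Suc d..l}"
    using h2 by (rule bij_betw_cong [THEN iffD1, rotated]) (use disj in \<open>auto simp: p_def\<close>)
  have p3: "bij_betw p ({1..n} - fst ` Z) {Suc l..n}"
    using h3 by (rule bij_betw_cong [THEN iffD1, rotated]) (use \<open>E \<subseteq> Z\<close> in \<open>auto simp: p_def\<close>)
  have "fst ` E \<union> fst ` (Z - E) = fst ` Z" using \<open>E \<subseteq> Z\<close> by auto
  moreover have "{1..d} \<union> {Suc d..l} = {1..l}" using \<open>d \<le> l\<close> by auto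
  ultimately have p12: "bij_betw p (fst ` Z) {1..l}"
    using bij_betw_combine [OF p1 p2] by auto
  have "fst ` Z \<union> ({1..n} - fst ` Z) = {1..n}" using ZD(1) by auto
  moreover have "{1..l} \<union> {Suc l..n} = {1..n}" using \<open>l \<le> n\<close> by auto
  ultimately have p: "bij_betw p {1..n} {1..n}"
    using bij_betw_combine [OF p12 p3] by auto
  \<comment> \<open>The sign that \<open>Z\<close> uses at coordinate \<open>x\<close>; off \<open>Z\<close> the value 1 makes the swap the identity.\<close>
  define s where "s x = (if x \<in> fst ` Z then snd (the_inv_into Z fst x) else 1)" for x
  have s_Z: "s (fst z) = snd z" if "z \<in> Z" for z
    using that ZD(2) by (simp add: s_def the_inv_into_f_f)
  have s_range: "s x \<in> {1..k}" if "0 < k" for x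
  proof (cases "x \<in> fst ` Z")
    case True
    then obtain z where "z \<in> Z" "x = fst z" by auto
    then show ?thesis using s_Z ZD(1) by auto
  next
    case False
    then show ?thesis using that by (simp add: s_def)
  qed
  define \<sigma> where "\<sigma> = (\<lambda>(x, y). (p x, transpose (s x) 1 y))"
  let ?B = "{1..n} \<times> {1..k}"
  have tr: "transpose (s x) 1 y \<in> {1..k}" if "y \<in> {1..k}" for x y
    using that s_range [of x] by (auto simp: transpose_def)
  have pin: "p x \<in> {1..n}" if "x \<in> {1..n}" for x
    using p that by (auto simp: bij_betw_def)
  have injp: "p x = p x' \<longleftrightarrow> x = x'" if "x \<in> {1..n}" "x' \<in> {1..n}" for x x'
    using p that by (auto simp: bij_betw_def inj_on_eq_iff)
  have "inj_on \<sigma> ?B"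
  proof (rule inj_onI)
    fix a b assume ab: "a \<in> ?B" "b \<in> ?B" and eq: "\<sigma> a = \<sigma> b"
    obtain x y where a: "a = (x, y)" by force
    obtain x' y' where b: "b = (x', y')" by force
    have "p x = p x'" using eq by (simp add: a b \<sigma>_def)
    then have "x = x'" using ab by (simp add: injp a b)
    moreover have "transpose (s x) 1 y = transpose (s x') 1 y'" using eq by (simp add: a b \<sigma>_def)
    ultimately have "y = y'" by (metis transpose_involutory)
    then show "a = b" using \<open>x = x'\<close> by (simp add: a b)
  qed
  moreover have sub: "\<sigma> ` ?B \<subseteq> ?B"
    using pin tr unfolding \<sigma>_def by fastforce
  ultimately have "\<sigma> ` ?B = ?B" by (intro endo_inj_surj) auto
  then have bij: "bij_betw \<sigma> ?B ?B" using \<open>inj_on \<sigma> ?B\<close> by (simp add: bij_betw_def)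
  have "signed_symmetry n k \<sigma>"
    unfolding signed_symmetry_def using bij injp by (auto simp: \<sigma>_def)
  moreover have im: "\<sigma> ` A = (\<lambda>x. (x, 1)) ` p ` fst ` A" if "A \<subseteq> Z" for A
  proof -
    have "\<sigma> z = (p (fst z), 1)" if "z \<in> Z" for z
      using s_Z [OF that] by (cases z) (simp add: \<sigma>_def)
    then have "\<sigma> ` A = (\<lambda>z. (p (fst z), 1)) ` A" using that by (intro image_cong) auto
    then show ?thesis by (simp add: image_image)
  qed
  have M_im: "M e = (\<lambda>x. (x, 1)) ` {1..e}" for e by (auto simp: M_def)
  have "\<sigma> ` E = M d" using im [OF \<open>E \<subseteq> Z\<close>] p1 by (simp add: bij_betw_def M_im)
  moreover have "\<sigma> ` Z = M l" using im [of Z] p12 by (simp add: bij_betw_def M_im)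
  ultimately show thesis using that by blast
qed

text \<open>All signed \<open>r\<close>-sets containing \<open>S\<close>.\<close>

definition star :: "nat \<Rightarrow> nat \<Rightarrow> nat \<Rightarrow> (nat \<times> nat) set \<Rightarrow> (nat \<times> nat) set set" where
  "star n r k S = {F \<in> signed_sets n r k. S \<subseteq> F}"

text \<open>The common size of the stars of all signed \<open>s\<close>-sets; \<open>M s\<close> serves as the representative.\<close>

definition star_size :: "nat \<Rightarrow> nat \<Rightarrow> nat \<Rightarrow> nat \<Rightarrow> nat" where
  "star_size n r k s = card (star n r k (M s))"

lemma finite_star [simp]: "finite (star n r k S)"
  by (simp add: star_def finite_signed_sets)

lemma star_mono: "S \<subseteq> S' \<Longrightarrow> star n r k S' \<subseteq> star n r k S"
  by (auto simp: star_def)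

lemma card_star:
  assumes S: "S \<in> signed_sets n s k"
  shows "card (star n r k S) = star_size n r k s"
proof -
  obtain \<sigma> where \<sigma>: "signed_symmetry n k \<sigma>" "\<sigma> ` S = M s"
    using signed_symmetry_exists [OF S subset_refl] signed_setsD(3) [OF S] by metis
  have bij: "bij_betw (image \<sigma>) (signed_sets n r k) (signed_sets n r k)"
    by (rule signed_symmetry_bij [OF \<sigma>(1)])
  have inj: "inj_on \<sigma> ({1..n} \<times> {1..k})"
    using \<sigma>(1) by (simp add: signed_symmetry_def bij_betw_def)
  have iff: "M s \<subseteq> \<sigma> ` F \<longleftrightarrow> S \<subseteq> F" if "F \<in> signed_sets n r k" for F
  proof -
    have "S \<subseteq> {1..n} \<times> {1..k}" "F \<subseteq> {1..n} \<times> {1..k}"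
      using signed_setsD(1) S that by blast+
    then show ?thesis unfolding \<sigma>(2) [symmetric] using inj by (blast dest: inj_onD)
  qed
  have "image \<sigma> ` star n r k S = star n r k (M s)"
  proof
    show "image \<sigma> ` star n r k S \<subseteq> star n r k (M s)"
      using bij iff by (fastforce simp: star_def bij_betw_def)
    show "star n r k (M s) \<subseteq> image \<sigma> ` star n r k S"
    proof
      fix G assume "G \<in> star n r k (M s)"
      then have G: "G \<in> signed_sets n r k" "M s \<subseteq> G" by (auto simp: star_def)
      then obtain F where "F \<in> signed_sets n r k" "G = \<sigma> ` F"
        using bij unfolding bij_betw_def by blast
      then show "G \<in> image \<sigma> ` star n r k S" using G iff by (auto simp: star_def)
    qed
  qed
  moreover have "inj_on (image \<sigma>) (star n r k S)"
    using bij by (auto simp: bij_betw_def star_def intro: inj_on_subset)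
  ultimately show ?thesis by (metis card_image star_size_def)
qed

lemma star_size_antimono: "s \<le> s' \<Longrightarrow> star_size n r k s' \<le> star_size n r k s"
  unfolding star_size_def by (intro card_mono star_mono M_mono) auto

lemma star_size_eq_0: "r < s \<Longrightarrow> star_size n r k s = 0"
proof -
  assume "r < s"
  have "star n r k (M s) = {}"
  proof (rule equals0I)
    fix F assume "F \<in> star n r k (M s)"
    then have F: "F \<in> signed_sets n r k" "M s \<subseteq> F" by (auto simp: star_def)
    then have "card (M s) \<le> card F" using signed_setsD(4) by (intro card_mono)
    then show False using \<open>r < s\<close> signed_setsD(3) [OF F(1)] by simp
  qed
  then show ?thesis by (simp add: star_size_def)
qed

lemma star_size_pos:
  assumes "s \<le> r" "r \<le> n" "0 < k"
  shows "0 < star_size n r k s"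
proof -
  have "M r \<in> star n r k (M s)" using assms M_signed M_mono by (simp add: star_def)
  then show ?thesis by (metis card_gt_0_iff empty_iff finite_star star_size_def)
qed

text \<open>Double counting of the pairs consisting of an \<open>r\<close>-set \<open>F \<supseteq> M s\<close> and a point of \<open>F\<close>
  outside \<open>M s\<close>.\<close>

lemma star_size_Suc:
  assumes "s \<le> r" "r \<le> n" "0 < k"
  shows "star_size n r k (Suc s) * ((n - s) * k) = star_size n r k s * (r - s)"
proof -
  let ?P = "{Suc s..n} \<times> {1..k}" and ?X = "star n r k (M s)"
  have M: "M s \<in> signed_sets n s k" using assms by (intro M_signed) auto
  have "fst ` M s = {1..s}" by (force simp: M_def)
  have "(\<Sum>w\<in>?P. card {F \<in> ?X. w \<in> F}) = (\<Sum>F\<in>?X. card {w \<in> ?P. w \<in> F})"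
    using sum.swap [of "\<lambda>w F. if w \<in> F then 1 else 0::nat" ?X ?P]
    by (simp add: sum.If_cases Int_def)
  also have "\<dots> = (\<Sum>F\<in>?X. r - s)"
  proof (intro sum.cong refl)
    fix F assume "F \<in> ?X"
    then have F: "F \<in> signed_sets n r k" "M s \<subseteq> F" by (auto simp: star_def)
    note FD = signed_setsD [OF F(1)]
    have "{w \<in> ?P. w \<in> F} = F - M s"
    proof
      show "{w \<in> ?P. w \<in> F} \<subseteq> F - M s" by (auto simp: M_def)
      show "F - M s \<subseteq> {w \<in> ?P. w \<in> F}"
      proof
        fix w assume w: "w \<in> F - M s"
        have "fst w \<notin> {1..s}"
        proof
          assume "fst w \<in> {1..s}"
          then have "(fst w, 1) \<in> M s" by (auto simp: M_def)
          then have "(fst w, 1) \<in> F" using F by blast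
          then have "w = (fst w, 1)" using w by (intro inj_onD [OF FD(2)]) auto
          then show False using w \<open>(fst w, 1) \<in> M s\<close> by simp
        qed
        moreover have "w \<in> {1..n} \<times> {1..k}" using w FD(1) by auto
        ultimately show "w \<in> {w \<in> ?P. w \<in> F}" using w by (cases w) auto
      qed
    qed
    then show "card {w \<in> ?P. w \<in> F} = r - s" using FD F by (simp add: card_Diff_subset)
  qed
  finally have 1: "(\<Sum>w\<in>?P. card {F \<in> ?X. w \<in> F}) = star_size n r k s * (r - s)"
    by (simp add: star_size_def)
  have "card {F \<in> ?X. w \<in> F} = star_size n r k (Suc s)" if "w \<in> ?P" for w
  proof -
    have "insert w (M s) \<in> signed_sets n (Suc s) k"
      using that M signed_sets_insert [of "M s" n s k "fst w" "snd w"] \<open>fst ` M s = {1..s}\<close>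
      by (cases w) auto
    moreover have "{F \<in> ?X. w \<in> F} = star n r k (insert w (M s))" by (auto simp: star_def)
    ultimately show ?thesis by (simp add: card_star)
  qed
  then have "(\<Sum>w\<in>?P. card {F \<in> ?X. w \<in> F}) = (n - s) * k * star_size n r k (Suc s)"
    by (simp add: card_cartesian_product)
  then show ?thesis using 1 by (simp add: mult.commute)
qed

section \<open>Covers and branching\<close>

text \<open>Sets meeting every member of the family in at least \<open>t\<close> points.\<close>

definition t_cover :: "nat \<Rightarrow> 'a set set \<Rightarrow> 'a set \<Rightarrow> bool" where
  "t_cover t \<F> S \<longleftrightarrow> (\<forall>F\<in>\<F>. t \<le> card (F \<inter> S))"

text \<open>Let \<open>G\<close> be a member with \<open>card (G \<inter> S) = p < t\<close>. A member \<open>F \<supseteq> S\<close> meets \<open>G\<close> in \<open>t - p\<close> or more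
  points with coordinates outside \<open>S\<close>, so it hits every set obtained from these points of \<open>G\<close> by
  leaving out \<open>t - p - 1\<close> of them. There are at most \<open>r - p\<close> of them because they lie in \<open>G - S\<close>, and
  at most \<open>n - s\<close> because their coordinates are distinct and avoid \<open>S\<close>.\<close>

lemma branching_set:
  assumes sub: "\<F> \<subseteq> signed_sets n r k" and inter: "t_intersecting t \<F>"
    and S: "S \<in> signed_sets n s k" and "t \<le> s" and not_cover: "\<not> t_cover t \<F> S"
  obtains W where "finite W" "card W \<le> min (r + 1) n - t"
    "\<And>w. w \<in> W \<Longrightarrow> insert w S \<in> signed_sets n (Suc s) k"
    "\<And>F. F \<in> \<F> \<Longrightarrow> S \<subseteq> F \<Longrightarrow> W \<inter> F \<noteq> {}"
proof -
  from not_cover obtain G where G: "G \<in> \<F>" and p: "card (G \<inter> S) < t"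
    by (auto simp: t_cover_def not_le)
  note GD = signed_setsD [OF subsetD [OF sub G]] and SD = signed_setsD [OF S]
  define p where "p = card (G \<inter> S)"
  define G' where "G' = {w \<in> G. fst w \<notin> fst ` S}"
  have fin: "finite G'" using GD(4) by (simp add: G'_def)
  have "G' \<subseteq> G - G \<inter> S" by (auto simp: G'_def)
  then have "card G' \<le> card (G - G \<inter> S)" using GD(4) by (intro card_mono) auto
  then have c1: "card G' \<le> r - p"
    using GD by (simp add: card_Diff_subset p_def)
  have "inj_on fst G'" using GD(2) by (rule inj_on_subset) (auto simp: G'_def)
  then have "card G' = card (fst ` G')" by (simp add: card_image)
  also have "\<dots> \<le> card ({1..n} - fst ` S)"
    using GD(1) by (intro card_mono) (auto simp: G'_def)
  also have "\<dots> = n - s"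
    using SD by (subst card_Diff_subset) (auto simp: card_image)
  finally have c2: "card G' \<le> n - s" .
  have "p < t" using p by (simp add: p_def)
  then have "card G' + 1 - (t - p) \<le> card G'" by linarith
  then obtain W where W: "W \<subseteq> G'" "card W = card G' + 1 - (t - p)"
    by (rule obtain_subset_with_card_n)
  have "p \<le> r" unfolding p_def using GD by (metis card_mono inf_le1)
  have "s \<le> n" using S by (rule signed_sets_card_le)
  have hit: "W \<inter> F \<noteq> {}" if F: "F \<in> \<F>" "S \<subseteq> F" for F
  proof
    assume "W \<inter> F = {}"
    note FD = signed_setsD [OF subsetD [OF sub F(1)]]
    \<comment> \<open>At a coordinate of \<open>S\<close> the set \<open>F\<close> has the same sign as \<open>S\<close>.\<close>
    have "F \<inter> G \<subseteq> G \<inter> S \<union> F \<inter> G'"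
    proof
      fix w assume w: "w \<in> F \<inter> G"
      show "w \<in> G \<inter> S \<union> F \<inter> G'"
      proof (cases "fst w \<in> fst ` S")
        case True
        then obtain w' where "w' \<in> S" "fst w = fst w'" by auto
        then have "w = w'" using w F(2) by (intro inj_onD [OF FD(2)]) auto
        then show ?thesis using w \<open>w' \<in> S\<close> by auto
      next
        case False
        then show ?thesis using w by (auto simp: G'_def)
      qed
    qed
    then have "card (F \<inter> G) \<le> card (G \<inter> S \<union> F \<inter> G')"
      using GD(4) fin by (intro card_mono) auto
    also have "\<dots> \<le> p + card (F \<inter> G')" unfolding p_def by (rule card_Un_le)
    finally have "t \<le> p + card (F \<inter> G')"
      using inter G F unfolding t_intersecting_def by (meson le_trans)
    moreover have "card (F \<inter> G') \<le> card (G' - W)"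
      using fin \<open>W \<inter> F = {}\<close> by (intro card_mono) auto
    moreover have "card (G' - W) = card G' - card W"
      using fin W(1) by (meson card_Diff_subset finite_subset)
    ultimately show False using \<open>p < t\<close> W(2) by linarith
  qed
  have ins: "insert w S \<in> signed_sets n (Suc s) k" if "w \<in> W" for w
  proof -
    have "w \<in> G" "fst w \<notin> fst ` S" using that W(1) by (auto simp: G'_def)
    moreover then have "fst w \<in> {1..n}" "snd w \<in> {1..k}" using GD(1) by auto
    ultimately show ?thesis using signed_sets_insert [OF S, of "fst w" "snd w"] by simp
  qed
  have "card W \<le> min (r + 1) n - t"
    using W(2) c1 c2 \<open>p < t\<close> \<open>t \<le> s\<close> \<open>p \<le> r\<close> \<open>s \<le> n\<close> by linarith
  moreover have "finite W" using W(1) fin by (rule finite_subset)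
  ultimately show thesis using that ins hit by blast
qed

lemma card_le_branching:
  assumes sub: "\<F> \<subseteq> signed_sets n r k" and inter: "t_intersecting t \<F>"
    and S: "S \<in> signed_sets n s k" and "t \<le> s" and not_cover: "\<not> t_cover t \<F> S"
    and "\<G> \<subseteq> \<F>"
    and b: "\<And>w. insert w S \<in> signed_sets n (Suc s) k \<Longrightarrow> card {F \<in> \<G>. insert w S \<subseteq> F} \<le> b"
  shows "card {F \<in> \<G>. S \<subseteq> F} \<le> (min (r + 1) n - t) * b"
proof -
  obtain W where W: "finite W" "card W \<le> min (r + 1) n - t"
    "\<And>w. w \<in> W \<Longrightarrow> insert w S \<in> signed_sets n (Suc s) k"
    "\<And>F. F \<in> \<F> \<Longrightarrow> S \<subseteq> F \<Longrightarrow> W \<inter> F \<noteq> {}"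
    using branching_set [OF sub inter S \<open>t \<le> s\<close> not_cover] by blast
  have fin: "finite \<G>" by (rule finite_subset [OF order_trans [OF \<open>\<G> \<subseteq> \<F>\<close> sub] finite_signed_sets])
  have "{F \<in> \<G>. S \<subseteq> F} \<subseteq> (\<Union>w\<in>W. {F \<in> \<G>. insert w S \<subseteq> F})"
  proof
    fix F assume "F \<in> {F \<in> \<G>. S \<subseteq> F}"
    moreover from this have "W \<inter> F \<noteq> {}" using \<open>\<G> \<subseteq> \<F>\<close> by (intro W(4)) auto
    ultimately show "F \<in> (\<Union>w\<in>W. {F \<in> \<G>. insert w S \<subseteq> F})" by auto
  qed
  then have "card {F \<in> \<G>. S \<subseteq> F} \<le> card (\<Union>w\<in>W. {F \<in> \<G>. insert w S \<subseteq> F})"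
    using fin W(1) by (intro card_mono) auto
  also have "\<dots> \<le> (\<Sum>w\<in>W. card {F \<in> \<G>. insert w S \<subseteq> F})"
    using W(1) by (rule card_UN_le)
  also have "\<dots> \<le> (\<Sum>w\<in>W. b)" by (intro sum_mono b W(3))
  also have "\<dots> = card W * b" by simp
  also have "\<dots> \<le> (min (r + 1) n - t) * b" using W(2) by simp
  finally show ?thesis .
qed

text \<open>As long as the sets reached are smaller than every cover, branching can be repeated.\<close>

lemma card_le_branching_iter:
  assumes sub: "\<F> \<subseteq> signed_sets n r k" and inter: "t_intersecting t \<F>"
    and no_cover: "\<And>s S. s < \<tau> \<Longrightarrow> S \<in> signed_sets n s k \<Longrightarrow> \<not> t_cover t \<F> S"
    and "s \<le> \<tau>" "t \<le> s" "S \<in> signed_sets n s k"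
  shows "card {F \<in> \<F>. S \<subseteq> F} \<le> (min (r + 1) n - t) ^ (\<tau> - s) * star_size n r k \<tau>"
  using \<open>s \<le> \<tau>\<close> \<open>t \<le> s\<close> \<open>S \<in> signed_sets n s k\<close>
proof (induction s arbitrary: S rule: inc_induct)
  case base
  have "{F \<in> \<F>. S \<subseteq> F} \<subseteq> star n r k S" using sub by (auto simp: star_def)
  then have "card {F \<in> \<F>. S \<subseteq> F} \<le> card (star n r k S)" by (intro card_mono) auto
  then show ?case using base by (simp add: card_star)
next
  case (step s)
  have "card {F \<in> \<F>. S \<subseteq> F} \<le>
      (min (r + 1) n - t) * ((min (r + 1) n - t) ^ (\<tau> - Suc s) * star_size n r k \<tau>)"
  proof (rule card_le_branching [OF sub inter step.prems(2,1) _ subset_refl])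
    show "\<not> t_cover t \<F> S" using step.hyps step.prems by (intro no_cover)
    show "card {F \<in> \<F>. insert w S \<subseteq> F} \<le>
        (min (r + 1) n - t) ^ (\<tau> - Suc s) * star_size n r k \<tau>"
      if "insert w S \<in> signed_sets n (Suc s) k" for w
      using step.prems by (intro step.IH that) simp
  qed
  moreover have "\<tau> - s = Suc (\<tau> - Suc s)" using step.hyps by simp
  ultimately show ?case by (simp add: mult.assoc)
qed

lemma card_le_min_cover:
  assumes sub: "\<F> \<subseteq> signed_sets n r k" and inter: "t_intersecting t \<F>"
    and no_cover: "\<And>s S. s < \<tau> \<Longrightarrow> S \<in> signed_sets n s k \<Longrightarrow> \<not> t_cover t \<F> S"
    and T: "T \<in> signed_sets n \<tau> k" "t_cover t \<F> T" and "t \<le> \<tau>"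
  shows "card \<F> \<le> (\<tau> choose t) * ((min (r + 1) n - t) ^ (\<tau> - t) * star_size n r k \<tau>)"
proof -
  let ?A = "{A. A \<subseteq> T \<and> card A = t}" and ?b = "(min (r + 1) n - t) ^ (\<tau> - t) * star_size n r k \<tau>"
  note TD = signed_setsD [OF T(1)]
  have fin: "finite \<F>" using sub finite_signed_sets by (rule finite_subset)
  have finA: "finite ?A" using TD(4) by simp
  have "\<F> \<subseteq> (\<Union>A\<in>?A. {F \<in> \<F>. A \<subseteq> F})"
  proof
    fix F assume F: "F \<in> \<F>"
    then have "t \<le> card (F \<inter> T)" using T(2) by (auto simp: t_cover_def)
    then obtain A where "A \<subseteq> F \<inter> T" "card A = t"
      using obtain_subset_with_card_n by metis
    then show "F \<in> (\<Union>A\<in>?A. {F \<in> \<F>. A \<subseteq> F})" using F by auto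
  qed
  then have "card \<F> \<le> card (\<Union>A\<in>?A. {F \<in> \<F>. A \<subseteq> F})"
    using fin finA by (intro card_mono) auto
  also have "\<dots> \<le> (\<Sum>A\<in>?A. card {F \<in> \<F>. A \<subseteq> F})"
    using finA by (rule card_UN_le)
  also have "\<dots> \<le> (\<Sum>A\<in>?A. ?b)"
  proof (rule sum_mono)
    fix A assume "A \<in> ?A"
    then have "A \<in> signed_sets n t k" using signed_sets_subset [OF T(1)] by auto
    then show "card {F \<in> \<F>. A \<subseteq> F} \<le> ?b"
      using no_cover \<open>t \<le> \<tau>\<close> by (intro card_le_branching_iter [OF sub inter]) auto
  qed
  also have "\<dots> = (\<tau> choose t) * ?b" using n_subsets [OF TD(4), of t] TD(3) by simp
  finally show ?thesis .
qed

section \<open>Consequences of the lower bound on the number of signs\<close>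

text \<open>The numerical hypotheses on \<open>n\<close>, \<open>r\<close>, \<open>k\<close> and \<open>t\<close>.\<close>

locale signed_parameters =
  fixes n r k t :: nat
  assumes t_ge: "2 \<le> t" and n_ge: "t + 2 \<le> n" and r_ge: "t + 1 \<le> r" and r_le: "r \<le> n"
    and k_ge: "2 \<le> k" and k_ge_g: "g n r t \<le> real k"
begin

text \<open>The branching number; \<open>t + v = min (r + 1) n\<close> is the largest \<open>\<ell>\<close> for which
  \<open>\<H>\<^sub>1(n, r, k, \<ell>, t)\<close> is defined.\<close>

definition v :: nat where "v = min (r + 1) n - t"

abbreviation N :: "nat \<Rightarrow> nat" where "N \<equiv> star_size n r k"

lemma v_ge: "2 \<le> v" using n_ge r_ge by (simp add: v_def)

text \<open>By \<open>star_size_Suc\<close> the quotient of \<open>N (Suc s)\<close> by \<open>N s\<close> is \<open>(r - s) / ((n - s) * k)\<close>. This is at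
  most \<open>(r - t - 1) / ((n - t - 1) * k)\<close>, and multiplying \<open>k \<ge> g n r t\<close> out cancels
  \<open>(r - t - 1) / (n - t - 1)\<close>. If \<open>s \<ge> r\<close>, then \<open>N (Suc s) = 0\<close>.\<close>

lemma star_size_ratio:
  assumes "t + 1 \<le> s"
  shows "(v + 2) * ((t + 2) choose 2) * N (Suc s) \<le> N s"
    and "(v + 2) * v * N (Suc s) \<le> 2 * N s"
proof -
  let ?mx = "max (real ((t + 2) choose 2)) ((real r - real t + 1) / 2)"
  have "real (N (Suc s)) * (real v + 2) * ?mx \<le> real (N s)"
  proof (cases "s < r")
    case False
    then show ?thesis by (simp add: star_size_eq_0)
  next
    case True
    define a where "a = real n - real t - 1"
    define b where "b = real r - real t - 1"
    have "0 < a" "0 < b" "b \<le> a" using True assms n_ge r_le by (auto simp: a_def b_def)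
    have "(b + 4) * b / a * ?mx \<le> real k"
      using k_ge_g by (simp add: g_def a_def b_def algebra_simps)
    then have k: "(b + 4) * b * ?mx \<le> real k * a"
      using \<open>0 < a\<close> by (simp add: field_simps)
    have "real (N (Suc s) * ((n - s) * k)) = real (N s * (r - s))"
      using True r_le k_ge by (subst star_size_Suc) auto
    then have rec: "real (N (Suc s)) * ((real n - real s) * real k) = real (N s) * (real r - real s)"
      using True r_le by (simp add: of_nat_diff)
    have "(real s - real t - 1) * b \<le> (real s - real t - 1) * a"
      using assms \<open>b \<le> a\<close> by (intro mult_left_mono) auto
    then have cross: "(real r - real s) * a \<le> (real n - real s) * b"
      by (simp add: a_def b_def algebra_simps)
    have "(real n - real s) * (real (N (Suc s)) * (real k * a)) = real (N s) * ((real r - real s) * a)"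
      using rec by (metis (no_types, opaque_lifting) mult.assoc mult.commute)
    also have "\<dots> \<le> real (N s) * ((real n - real s) * b)"
      using cross by (intro mult_left_mono) auto
    also have "\<dots> = (real n - real s) * (real (N s) * b)" by simp
    finally have "real (N (Suc s)) * (real k * a) \<le> real (N s) * b"
      using True r_le by (simp add: mult_le_cancel_left)
    then have "real (N (Suc s)) * ((b + 4) * b * ?mx) \<le> real (N s) * b"
      using k by (meson mult_left_mono of_nat_0_le_iff order_trans)
    then have "b * (real (N (Suc s)) * ((b + 4) * ?mx)) \<le> b * real (N s)"
      by (simp add: algebra_simps)
    then have *: "real (N (Suc s)) * ((b + 4) * ?mx) \<le> real (N s)"
      using \<open>0 < b\<close> by simp
    have "real v + 2 \<le> b + 4" using r_ge n_ge by (simp add: v_def b_def)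
    then have "(real v + 2) * ?mx \<le> (b + 4) * ?mx" by (intro mult_right_mono) auto
    then have "real (N (Suc s)) * ((real v + 2) * ?mx) \<le> real (N (Suc s)) * ((b + 4) * ?mx)"
      by (intro mult_left_mono) auto
    then show ?thesis using * by (simp only: mult.assoc)
  qed
  then have mx: "real (N (Suc s)) * (real v + 2) * x \<le> real (N s)" if "x \<le> ?mx" for x
    using mult_left_mono [OF that, of "real (N (Suc s)) * (real v + 2)"] by simp
  have "real ((v + 2) * ((t + 2) choose 2) * N (Suc s)) \<le> real (N s)"
    using mx [of "real ((t + 2) choose 2)"] by (simp add: algebra_simps)
  then show "(v + 2) * ((t + 2) choose 2) * N (Suc s) \<le> N s" by (simp only: of_nat_le_iff)
  have "real v \<le> real r - real t + 1" using n_ge r_ge by (simp add: v_def)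
  then have "real v / 2 \<le> ?mx" by (intro max.coboundedI2 divide_right_mono) auto
  from mx [OF this] have "real ((v + 2) * v * N (Suc s)) \<le> real (2 * N s)"
    by (simp add: algebra_simps)
  then show "(v + 2) * v * N (Suc s) \<le> 2 * N s" by (simp only: of_nat_le_iff)
qed

text \<open>The bound that branching yields from a cover of size \<open>s\<close> decreases in \<open>s\<close>, as
  \<open>(Suc s choose t) \<le> (t + 1) * (s choose t)\<close> and \<open>t + 1\<close> is at most \<open>(t + 2) choose 2\<close>.\<close>

lemma choose_star_size_antimono:
  assumes "t + 2 \<le> s"
  shows "(s choose t) * (v ^ (s - t) * N s) \<le> ((t + 2) choose 2) * (v ^ 2 * N (t + 2))"
  using assms
proof (induction s rule: dec_induct)
  case base
  have "((t + 2) choose t) = ((t + 2) choose 2)" using binomial_symmetric [of 2 "t + 2"] by simp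
  then show ?case by simp
next
  case (step s)
  let ?c = "(t + 2) choose 2"
  have "?c = (t + 2) * (t + 1) div 2" by (simp add: choose_two)
  then have c: "t + 1 \<le> ?c" by simp
  have "Suc s * (s choose t) = (Suc s - t) * (Suc s choose t)"
    using binomial_absorb_comp [of "Suc s" t] by simp
  moreover have "Suc s \<le> (t + 1) * (Suc s - t)"
  proof -
    have "s = t + (s - t)" using step.hyps by simp
    then obtain d where "s = t + d" by metis
    then show ?thesis by simp
  qed
  ultimately have "(Suc s - t) * (Suc s choose t) \<le> ((t + 1) * (Suc s - t)) * (s choose t)"
    by (metis mult_le_mono1)
  also have "\<dots> = (Suc s - t) * ((t + 1) * (s choose t))" by (simp only: mult.assoc mult.left_commute)
  finally have "(Suc s choose t) \<le> (t + 1) * (s choose t)"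
    using step.hyps by (simp only: mult_le_cancel1)
  also have "\<dots> \<le> ?c * (s choose t)" using c by (rule mult_le_mono1)
  finally have 1: "(Suc s choose t) \<le> ?c * (s choose t)" .
  have e: "v ^ (Suc s - t) = v ^ (s - t) * v" using step.hyps by (simp add: Suc_diff_le)
  have "(Suc s choose t) * (v ^ (Suc s - t) * N (Suc s)) \<le>
      (?c * (s choose t)) * (v ^ (Suc s - t) * N (Suc s))" using 1 by (rule mult_le_mono1)
  also have "\<dots> = (s choose t) * (v ^ (s - t) * (v * ?c * N (Suc s)))"
    unfolding e by (simp only: mult_ac)
  also have "\<dots> \<le> (s choose t) * (v ^ (s - t) * N s)"
  proof (intro mult_le_mono order_refl)
    have "v * ?c * N (Suc s) \<le> (v + 2) * ?c * N (Suc s)" by (intro mult_le_mono) auto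
    also have "\<dots> \<le> N s" using step.hyps by (intro star_size_ratio) auto
    finally show "v * ?c * N (Suc s) \<le> N s" .
  qed
  finally show ?case using step.IH by linarith
qed

end

section \<open>The Hilton--Milner type families\<close>

text \<open>The family \<open>\<H>\<^sub>1\<close> with \<open>M t \<subseteq> M \<ell>\<close> replaced by an arbitrary pair \<open>E \<subseteq> Z\<close>.\<close>

definition hm_family ::
  "nat \<Rightarrow> nat \<Rightarrow> nat \<Rightarrow> nat \<Rightarrow> (nat \<times> nat) set \<Rightarrow> (nat \<times> nat) set \<Rightarrow> (nat \<times> nat) set set" where
  "hm_family n r k t E Z =
     {F \<in> signed_sets n r k.
        (E \<subseteq> F \<and> t + 1 \<le> card (F \<inter> Z)) \<or> (\<not> E \<subseteq> F \<and> card (F \<inter> Z) = card Z - 1)}"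

lemma hm_family_iso_H1:
  assumes Z: "Z \<in> signed_sets n l k" and E: "E \<subseteq> Z" "card E = t"
  shows "family_iso n k (hm_family n r k t E Z) (H1 n r k l t)"
    and "card (hm_family n r k t E Z) = card (H1 n r k l t)"
proof -
  let ?B = "{1..n} \<times> {1..k}"
  obtain \<sigma> where \<sigma>: "signed_symmetry n k \<sigma>" "\<sigma> ` E = M t" "\<sigma> ` Z = M l"
    using signed_symmetry_exists [OF Z E] by blast
  have bij: "bij_betw (image \<sigma>) (signed_sets n r k) (signed_sets n r k)"
    by (rule signed_symmetry_bij [OF \<sigma>(1)])
  have bijB: "bij_betw \<sigma> ?B ?B" using \<sigma>(1) by (simp add: signed_symmetry_def)
  then have inj: "inj_on \<sigma> ?B" by (simp add: bij_betw_def)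
  have ZB: "Z \<subseteq> ?B" using signed_setsD(1) [OF Z] .
  have iff: "\<sigma> ` F \<in> H1 n r k l t \<longleftrightarrow> F \<in> hm_family n r k t E Z"
    if F: "F \<in> signed_sets n r k" for F
  proof -
    have FB: "F \<subseteq> ?B" using signed_setsD(1) [OF F] .
    have "\<sigma> ` F \<in> signed_sets n r k" using bij F by (auto simp: bij_betw_def)
    moreover have "M t \<subseteq> \<sigma> ` F \<longleftrightarrow> E \<subseteq> F"
      unfolding \<sigma>(2) [symmetric] using inj FB ZB E(1) by (blast dest: inj_onD)
    moreover have "card (\<sigma> ` F \<inter> M l) = card (F \<inter> Z)"
    proof -
      have "\<sigma> ` F \<inter> M l = \<sigma> ` (F \<inter> Z)"
        unfolding \<sigma>(3) [symmetric] using inj FB ZB by (simp add: inj_on_image_Int)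
      moreover have "inj_on \<sigma> (F \<inter> Z)" using inj FB by (auto intro: inj_on_subset)
      ultimately show ?thesis by (simp add: card_image)
    qed
    ultimately show ?thesis using F signed_setsD(3) [OF Z] by (simp add: H1_def hm_family_def)
  qed
  have im: "H1 n r k l t = image \<sigma> ` hm_family n r k t E Z"
  proof
    show "H1 n r k l t \<subseteq> image \<sigma> ` hm_family n r k t E Z"
    proof
      fix G assume G: "G \<in> H1 n r k l t"
      then have "G \<in> signed_sets n r k" by (simp add: H1_def)
      then obtain F where "F \<in> signed_sets n r k" "G = \<sigma> ` F"
        using bij unfolding bij_betw_def by blast
      then show "G \<in> image \<sigma> ` hm_family n r k t E Z" using G iff by blast
    qed
    show "image \<sigma> ` hm_family n r k t E Z \<subseteq> H1 n r k l t"
      using iff by (auto simp: hm_family_def)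
  qed
  then show "family_iso n k (hm_family n r k t E Z) (H1 n r k l t)"
    unfolding family_iso_def Setcompr_eq_image using bijB by blast
  have "inj_on (image \<sigma>) (hm_family n r k t E Z)"
    using bij by (auto simp: bij_betw_def hm_family_def intro: inj_on_subset)
  then show "card (hm_family n r k t E Z) = card (H1 n r k l t)"
    unfolding im by (simp add: card_image)
qed

lemma finite_H1: "finite (H1 n r k l t)"
  by (rule finite_subset [OF _ finite_signed_sets]) (auto simp: H1_def)

lemma card_Int_subset_ge:
  assumes "A \<subseteq> Z" "B \<subseteq> Z" "finite Z"
  shows "card A + card B \<le> card Z + card (A \<inter> B)"
proof -
  have "finite A" "finite B" using assms finite_subset by auto
  then have "card A + card B = card (A \<union> B) + card (A \<inter> B)" by (rule card_Un_Int)
  moreover have "card (A \<union> B) \<le> card Z" using assms by (intro card_mono) auto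
  ultimately show ?thesis by simp
qed

context signed_parameters
begin

text \<open>If one of the two members misses a point of \<open>M t\<close>, then their traces on \<open>M l\<close> have total size
  at least \<open>l + t\<close>.\<close>

lemma H1_t_intersecting:
  assumes "t + 2 \<le> l"
  shows "t_intersecting t (H1 n r k l t)"
  unfolding t_intersecting_def
proof (intro ballI)
  fix F F' assume FF: "F \<in> H1 n r k l t" "F' \<in> H1 n r k l t"
  then have fin: "finite F" "finite F'" using signed_setsD(4) by (auto simp: H1_def)
  show "t \<le> card (F \<inter> F')"
  proof (cases "M t \<subseteq> F \<and> M t \<subseteq> F'")
    case True
    then have "card (M t) \<le> card (F \<inter> F')" using fin by (intro card_mono) auto
    then show ?thesis by simp
  next
    case False
    have "l + t \<le> card (F \<inter> M l) + card (F' \<inter> M l)"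
      using False FF assms by (auto simp: H1_def)
    also have "\<dots> \<le> card (M l) + card ((F \<inter> M l) \<inter> (F' \<inter> M l))"
      by (intro card_Int_subset_ge) auto
    also have "card ((F \<inter> M l) \<inter> (F' \<inter> M l)) \<le> card (F \<inter> F')"
      using fin by (intro card_mono) auto
    finally show ?thesis by simp
  qed
qed

text \<open>Some member omits \<open>(1, 1) \<in> M t\<close>, and every point outside \<open>M t\<close> is omitted by some extension
  of \<open>M t\<close> together with \<open>(t + 1, 1)\<close> or with \<open>(t + 2, 1)\<close>.\<close>

lemma H1_nontrivial:
  assumes "t + 2 \<le> l" "l \<le> r + 1" "l \<le> n"
  shows "nontrivial_t_intersecting n r k t (H1 n r k l t)"
  unfolding nontrivial_t_intersecting_def
proof (intro conjI)
  show "H1 n r k l t \<subseteq> signed_sets n r k" by (auto simp: H1_def)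
  show "t_intersecting t (H1 n r k l t)" using assms(1) by (rule H1_t_intersecting)
  show "\<not> trivial_family n k t (H1 n r k l t)"
  proof
    assume "trivial_family n k t (H1 n r k l t)"
    then obtain T where T: "T \<in> signed_sets n t k" "\<And>F. F \<in> H1 n r k l t \<Longrightarrow> T \<subseteq> F"
      by (auto simp: trivial_family_def)
    have Ml: "M l \<in> signed_sets n l k" using assms k_ge by (intro M_signed) auto
    show False
    proof (cases "T = M t")
      case True
      let ?S = "M l - {(1, 1)}"
      have 11: "(1, 1) \<in> M t" "(1, 1) \<in> M l" using t_ge assms by (auto simp: M_def)
      have "card ?S = l - 1" using 11 by simp
      then have "?S \<in> signed_sets n (l - 1) k" using signed_sets_subset [OF Ml, of ?S] by auto
      then obtain F where F: "F \<in> signed_sets n r k" "?S \<subseteq> F" "F \<inter> M l \<subseteq> ?S"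
        using signed_sets_extend [of ?S n "l - 1" k r "M l"] assms r_le k_ge signed_setsD(2) [OF Ml]
        by (metis le_diff_conv)
      then have eq: "F \<inter> M l = ?S" by blast
      have "\<not> M t \<subseteq> F" using eq 11 by blast
      then have "F \<in> H1 n r k l t" using F(1) eq \<open>card ?S = l - 1\<close> by (simp add: H1_def)
      then show False using T(2) True \<open>\<not> M t \<subseteq> F\<close> by blast
    next
      case False
      have "\<not> T \<subseteq> M t"
        using False card_subset_eq [of "M t" T] signed_setsD(3) [OF T(1)] by auto
      then obtain p where p: "p \<in> T" "p \<notin> M t" by blast
      define i where "i = (if p = (t + 1, 1) then t + 2 else t + 1)"
      have i: "i \<in> {1..n}" "i \<in> {1..l}" "(i, 1) \<noteq> p" "i \<notin> fst ` M t"
        using n_ge assms by (auto simp: i_def M_def)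
      let ?S = "insert (i, 1) (M t)"
      have iM: "(i, 1) \<in> M l" using i(2) by (auto simp: M_def)
      have iM': "(i, 1) \<notin> M t" using i(4) by (metis fst_conv image_eqI)
      have "?S \<in> signed_sets n (Suc t) k"
        using i k_ge n_ge by (intro signed_sets_insert M_signed) auto
      then obtain F where F: "F \<in> signed_sets n r k" "?S \<subseteq> F" "F \<inter> {p} \<subseteq> ?S"
        using signed_sets_extend [of ?S n "Suc t" k r "{p}"] r_ge r_le k_ge by auto
      have "card ?S \<le> card (F \<inter> M l)"
        using F(2) iM M_mono [of t l] assms by (intro card_mono) auto
      then have "F \<in> H1 n r k l t" using F iM' by (simp add: H1_def)
      then have "p \<in> F" using T(2) p by blast
      then show False using F(3) p i(3) by auto
    qed
  qed
qed

end

section \<open>Covers of a largest family\<close>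

locale largest_family = signed_parameters +
  fixes \<F> :: "(nat \<times> nat) set set"
  assumes largest: "largest_nontrivial_t_intersecting n r k t \<F>"
begin

lemma family_sub: "\<F> \<subseteq> signed_sets n r k"
  and family_inter: "t_intersecting t \<F>"
  and family_nontrivial: "\<not> trivial_family n k t \<F>"
  and card_family_ge: "nontrivial_t_intersecting n r k t \<G> \<Longrightarrow> card \<G> \<le> card \<F>"
  using largest
  by (auto simp: largest_nontrivial_t_intersecting_def nontrivial_t_intersecting_def)

lemma finite_family: "finite \<F>"
  using family_sub finite_signed_sets by (rule finite_subset)

lemma familyD:
  assumes "F \<in> \<F>"
  shows "F \<in> signed_sets n r k" "inj_on fst F" "card F = r" "finite F"
  using assms family_sub signed_setsD by auto

lemma family_maximal:
  assumes F: "F \<in> signed_sets n r k" and inter: "\<And>G. G \<in> \<F> \<Longrightarrow> t \<le> card (G \<inter> F)"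
  shows "F \<in> \<F>"
proof (rule ccontr)
  assume "F \<notin> \<F>"
  have "nontrivial_t_intersecting n r k t (insert F \<F>)"
    using family_sub family_inter family_nontrivial F inter r_ge signed_setsD(3) [OF F]
    by (auto simp: nontrivial_t_intersecting_def t_intersecting_def trivial_family_def Int_commute)
  then have "card (insert F \<F>) \<le> card \<F>" by (rule card_family_ge)
  then show False using \<open>F \<notin> \<F>\<close> finite_family by simp
qed

lemma H1_le_card_family:
  assumes "t + 2 \<le> l" "l \<le> r + 1" "l \<le> n"
  shows "card (H1 n r k l t) \<le> card \<F>"
  using assms by (intro card_family_ge H1_nontrivial)

text \<open>The family \<open>hm_family n r k t E Z\<close> has the size of the non-trivial \<open>t\<close>-intersecting family
  \<open>H1 n r k l t\<close>, so a largest such family inside it is all of it.\<close>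

lemma family_iso_H1:
  assumes "t + 2 \<le> l" "l \<le> r + 1" "l \<le> n"
    and Z: "Z \<in> signed_sets n l k" "E \<subseteq> Z" "card E = t" and "\<F> \<subseteq> hm_family n r k t E Z"
  shows "family_iso n k \<F> (H1 n r k l t)"
proof -
  have "card (hm_family n r k t E Z) \<le> card \<F>"
    using H1_le_card_family [OF assms(1-3)] hm_family_iso_H1(2) [OF Z] by simp
  moreover have "finite (hm_family n r k t E Z)"
    by (rule finite_subset [OF _ finite_signed_sets]) (auto simp: hm_family_def)
  ultimately have "\<F> = hm_family n r k t E Z"
    using assms(7) by (intro card_seteq) auto
  then show ?thesis using hm_family_iso_H1(1) [OF Z] by simp
qed

lemma no_small_cover:
  assumes "s < t + 1" "S \<in> signed_sets n s k"
  shows "\<not> t_cover t \<F> S"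
proof
  assume cover: "t_cover t \<F> S"
  note SD = signed_setsD [OF assms(2)]
  have "\<F> \<noteq> {}"
    using family_nontrivial M_signed [of t n k] n_ge k_ge by (auto simp: trivial_family_def)
  have "S \<subseteq> F \<and> s = t" if "F \<in> \<F>" for F
  proof -
    have "t \<le> card (F \<inter> S)" using cover that by (simp add: t_cover_def)
    moreover have "card (F \<inter> S) \<le> card S" using SD by (intro card_mono) auto
    ultimately have "card (F \<inter> S) = card S" "s = t" using assms(1) SD(3) by auto
    then show ?thesis using card_subset_eq [of S "F \<inter> S"] SD(4) by auto
  qed
  then have "trivial_family n k t \<F>"
    using \<open>\<F> \<noteq> {}\<close> assms(2) unfolding trivial_family_def by blast
  then show False using family_nontrivial by simp
qed

text \<open>The signed \<open>t\<close>-covers of size \<open>t + 1\<close>, the smallest size that a cover can have.\<close>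

definition covers :: "(nat \<times> nat) set set" where
  "covers = {T \<in> signed_sets n (t + 1) k. t_cover t \<F> T}"

lemma coversD:
  assumes "T \<in> covers"
  shows "T \<in> signed_sets n (t + 1) k" "card T = t + 1" "finite T" "inj_on fst T"
    "F \<in> \<F> \<Longrightarrow> t \<le> card (F \<inter> T)"
  using assms signed_setsD by (auto simp: covers_def t_cover_def)

lemma covers_superset:
  assumes T: "T \<in> covers" and "F \<in> signed_sets n r k" "T \<subseteq> F"
  shows "F \<in> \<F>"
proof (rule family_maximal [OF assms(2)])
  fix G assume "G \<in> \<F>"
  then have "t \<le> card (G \<inter> T)" using T coversD by blast
  also have "\<dots> \<le> card (G \<inter> F)"
    using \<open>T \<subseteq> F\<close> signed_setsD(4) [OF assms(2)] by (intro card_mono) auto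
  finally show "t \<le> card (G \<inter> F)" .
qed

lemma covers_intersect:
  assumes T: "T \<in> covers" and T': "T' \<in> covers"
  shows "t \<le> card (T \<inter> T')"
proof -
  have le: "t + 1 \<le> r" using r_ge by simp
  obtain F where F: "F \<in> signed_sets n r k" "T \<subseteq> F" "F \<inter> T' \<subseteq> T"
    using signed_sets_extend [OF coversD(1) [OF T] le r_le k_ge coversD(4) [OF T']] by blast
  obtain F' where F': "F' \<in> signed_sets n r k" "T' \<subseteq> F'" "F' \<inter> F \<subseteq> T'"
    using signed_sets_extend [OF coversD(1) [OF T'] le r_le k_ge signed_setsD(2) [OF F(1)]] by blast
  have "F \<in> \<F>" "F' \<in> \<F>" using covers_superset T T' F F' by auto
  then have "t \<le> card (F \<inter> F')" using family_inter by (auto simp: t_intersecting_def)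
  also have "\<dots> \<le> card (T \<inter> T')"
    using F F' coversD(3) [OF T] by (intro card_mono) auto
  finally show ?thesis .
qed

lemma covers_Int:
  assumes T: "T \<in> covers" "T' \<in> covers" "T \<noteq> T'"
  obtains a b where "a \<notin> T'" "b \<notin> T" "T = insert a (T \<inter> T')" "T' = insert b (T \<inter> T')"
    "card (T \<inter> T') = t"
proof -
  have "\<not> T \<subseteq> T'" "\<not> T' \<subseteq> T"
    using card_subset_eq [of T' T] card_subset_eq [of T T'] T coversD(2,3) by auto
  then have "T \<inter> T' \<subset> T" by auto
  then have "card (T \<inter> T') < t + 1"
    using psubset_card_mono [of T "T \<inter> T'"] coversD(2,3) [OF T(1)] by auto
  then have c: "card (T \<inter> T') = t" using covers_intersect [OF T(1,2)] by simp
  have "card (T - T') = 1" "card (T' - T) = 1"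
    using card_Diff_subset_Int [of T T'] card_Diff_subset_Int [of T' T] c coversD(2,3) T
    by (auto simp: Int_commute)
  then obtain a b where "T - T' = {a}" "T' - T = {b}" by (auto simp: card_1_singleton_iff)
  then show thesis using c by (intro that [of a b]) auto
qed

text \<open>If the \<open>(t + 1)\<close>-covers are not a star, three of them lie in a common signed \<open>(t + 2)\<close>-set
  \<open>Z\<close>, each missing a different point of \<open>Z\<close>; a member of the family missing two points of \<open>Z\<close>
  would meet one of the three in fewer than \<open>t\<close> points.\<close>

lemma covers_triangle:
  assumes T1: "T1 \<in> covers" and T2: "T2 \<in> covers" and T3: "T3 \<in> covers"
    and ne: "T1 \<noteq> T2" and nsub: "\<not> T1 \<inter> T2 \<subseteq> T3"
  shows "\<exists>Z\<in>signed_sets n (t + 2) k. \<forall>F\<in>\<F>. t + 1 \<le> card (F \<inter> Z)"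
proof -
  obtain a b where ab: "a \<notin> T2" "b \<notin> T1" "T1 = insert a (T1 \<inter> T2)" "T2 = insert b (T1 \<inter> T2)"
    "card (T1 \<inter> T2) = t"
    using covers_Int [OF T1 T2 ne] by blast
  define E where "E = T1 \<inter> T2"
  define Z where "Z = insert a (insert b E)"
  have T12: "T1 = insert a E" "T2 = insert b E" "a \<notin> E" "b \<notin> E" "a \<noteq> b" "card E = t"
    using ab unfolding E_def by auto
  have finE: "finite E" using T12(1) coversD(3) [OF T1] by simp
  have cZ: "card Z = t + 2" using T12 finE by (simp add: Z_def)
  obtain e where e: "e \<in> E" "e \<notin> T3" using nsub E_def by blast
  have "T3 \<noteq> T1" "T3 \<noteq> T2" using e T12 by auto
  obtain x where x: "T3 = insert x (T3 \<inter> T1)" "card (T3 \<inter> T1) = t"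
    using covers_Int [OF T3 T1 \<open>T3 \<noteq> T1\<close>] by metis
  obtain y where y: "T3 = insert y (T3 \<inter> T2)" "card (T3 \<inter> T2) = t"
    using covers_Int [OF T3 T2 \<open>T3 \<noteq> T2\<close>] by metis
  have cEe: "card (E - {e}) < t" using T12(6) e finE t_ge by simp
  have aT3: "a \<in> T3"
  proof (rule ccontr)
    assume "a \<notin> T3"
    then have "T3 \<inter> T1 \<subseteq> E - {e}" using T12(1) e by auto
    then show False using x(2) cEe finE card_mono [of "E - {e}" "T3 \<inter> T1"] by simp
  qed
  have bT3: "b \<in> T3"
  proof (rule ccontr)
    assume "b \<notin> T3"
    then have "T3 \<inter> T2 \<subseteq> E - {e}" using T12(2) e by auto
    then show False using y(2) cEe finE card_mono [of "E - {e}" "T3 \<inter> T2"] by simp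
  qed
  have "b \<notin> T1" using ab(2) .
  then have "x = b" using x(1) bT3 by (metis Int_iff insert_iff)
  then have T3Z: "T3 \<subseteq> Z" using x(1) T12(1) by (auto simp: Z_def)
  have "inj_on fst Z"
  proof (rule inj_onI)
    fix p q assume "p \<in> Z" "q \<in> Z" and eq: "fst p = fst q"
    then have "(p \<in> T1 \<and> q \<in> T1) \<or> (p \<in> T2 \<and> q \<in> T2) \<or> (p \<in> T3 \<and> q \<in> T3)"
      using aT3 bT3 T12 by (auto simp: Z_def)
    then show "p = q" using eq coversD(4) T1 T2 T3 by (auto dest: inj_onD)
  qed
  moreover have "Z \<subseteq> {1..n} \<times> {1..k}"
    using signed_setsD(1) [OF coversD(1) [OF T1]] signed_setsD(1) [OF coversD(1) [OF T2]] T12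
    by (auto simp: Z_def)
  ultimately have Z: "Z \<in> signed_sets n (t + 2) k" using cZ by (simp add: signed_sets_altdef)
  have finZ: "finite Z" using finE by (simp add: Z_def)
  have "t + 1 \<le> card (F \<inter> Z)" if F: "F \<in> \<F>" for F
  proof (rule ccontr)
    assume "\<not> ?thesis"
    then have "2 \<le> card (Z - F)"
      using card_Diff_subset_Int [of Z F] cZ finZ by (simp add: Int_commute)
    have miss: "u \<notin> F" if T: "T \<in> covers" "T \<subseteq> Z" and "u \<notin> T" "u \<in> Z" for T u
    proof
      assume "u \<in> F"
      have "card (Z - F) \<le> card (T - F)"
      proof (rule card_mono)
        have "Z = insert u T"
          using T \<open>u \<notin> T\<close> \<open>u \<in> Z\<close> finZ cZ coversD(2,3) [OF T(1)]
          by (intro card_subset_eq [symmetric]) auto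
        then show "Z - F \<subseteq> T - F" using \<open>u \<in> F\<close> by auto
        show "finite (T - F)" using coversD(3) [OF T(1)] by simp
      qed
      moreover have "card (T - F) = t + 1 - card (F \<inter> T)"
        using card_Diff_subset_Int [of T F] coversD(2,3) [OF T(1)] by (simp add: Int_commute)
      ultimately show False using \<open>2 \<le> card (Z - F)\<close> coversD(5) [OF T(1) F] by linarith
    qed
    have "b \<notin> F" "a \<notin> F" "e \<notin> F"
      using miss [OF T1, of b] miss [OF T2, of a] miss [OF T3, of e] ab e T12 T3Z
      by (auto simp: Z_def)
    then have "F \<inter> T1 \<subseteq> E - {e}" using T12 by auto
    then show False using coversD(5) [OF T1 F] cEe finE card_mono [of "E - {e}" "F \<inter> T1"] by simp
  qed
  then show ?thesis using Z by blast
qed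

lemma covers_star:
  assumes "covers \<noteq> {}"
    and no_triangle: "\<And>T1 T2 T3. T1 \<in> covers \<Longrightarrow> T2 \<in> covers \<Longrightarrow> T3 \<in> covers \<Longrightarrow>
      T1 \<noteq> T2 \<Longrightarrow> T1 \<inter> T2 \<subseteq> T3"
  shows "\<exists>E\<in>signed_sets n t k. \<forall>T\<in>covers. E \<subseteq> T"
proof -
  obtain T1 where T1: "T1 \<in> covers" using assms(1) by blast
  have E: "E \<in> signed_sets n t k" if "E \<subseteq> T1" "card E = t" for E
    using signed_sets_subset [OF coversD(1) [OF T1] that(1)] that(2) by simp
  show ?thesis
  proof (cases "covers = {T1}")
    case True
    obtain E where "E \<subseteq> T1" "card E = t"
      using obtain_subset_with_card_n [of t T1] coversD(2) [OF T1] by auto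
    then show ?thesis using E True by auto
  next
    case False
    then obtain T2 where T2: "T2 \<in> covers" "T1 \<noteq> T2" using T1 by blast
    then have "card (T1 \<inter> T2) = t" using covers_Int [OF T1 T2] by metis
    then show ?thesis using E [of "T1 \<inter> T2"] no_triangle [OF T1 T2(1)] T2(2) by blast
  qed
qed

end

section \<open>Sizes of unions\<close>

lemma card_UN_Bonferroni:
  assumes "finite I" and "\<And>i. i \<in> I \<Longrightarrow> finite (A i)" and "\<And>i. i \<in> I \<Longrightarrow> a \<le> card (A i)"
    and "\<And>i j. i \<in> I \<Longrightarrow> j \<in> I \<Longrightarrow> i \<noteq> j \<Longrightarrow> card (A i \<inter> A j) \<le> b"
  shows "card I * a \<le> card (\<Union>i\<in>I. A i) + (card I choose 2) * b"
  using assms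
proof (induction I rule: finite_induct)
  case empty
  then show ?case by simp
next
  case (insert i I)
  let ?U = "\<Union>j\<in>I. A j"
  have fin: "finite ?U" "finite (A i)" using insert.hyps(1) insert.prems(1) by auto
  have IH: "card I * a \<le> card ?U + (card I choose 2) * b"
    using insert.prems by (intro insert.IH) auto
  have "A i \<inter> ?U = (\<Union>j\<in>I. A i \<inter> A j)" by auto
  then have "card (A i \<inter> ?U) \<le> (\<Sum>j\<in>I. card (A i \<inter> A j))"
    using card_UN_le [OF insert.hyps(1), of "\<lambda>j. A i \<inter> A j"] by simp
  also have "\<dots> \<le> (\<Sum>j\<in>I. b)" using insert.hyps(2) by (intro sum_mono insert.prems(3)) auto
  finally have "card (A i \<inter> ?U) \<le> card I * b" by simp
  moreover have "card (A i) + card ?U = card (A i \<union> ?U) + card (A i \<inter> ?U)"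
    using fin by (intro card_Un_Int) auto
  moreover have "a \<le> card (A i)" using insert.prems(2) by simp
  moreover have "Suc (card I) choose 2 = card I + (card I choose 2)"
    using binomial_Suc_Suc [of "card I" 1] by (simp add: numeral_2_eq_2)
  ultimately show ?case using IH insert.hyps by (simp add: algebra_simps)
qed

text \<open>Cover the union by \<open>A i \<union> A j\<close> for two fixed indices and by the other \<open>A l\<close> with
  \<open>A i \<union> A j\<close> removed.\<close>

lemma card_UN_triple_bound:
  assumes "finite I" "2 \<le> card I" and fin: "\<And>i. i \<in> I \<Longrightarrow> finite (A i)"
    and a: "\<And>i. i \<in> I \<Longrightarrow> card (A i) = a"
    and b: "\<And>i j. i \<in> I \<Longrightarrow> j \<in> I \<Longrightarrow> i \<noteq> j \<Longrightarrow> card (A i \<inter> A j) = b"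
    and c: "\<And>i j l. i \<in> I \<Longrightarrow> j \<in> I \<Longrightarrow> l \<in> I \<Longrightarrow> i \<noteq> j \<Longrightarrow> i \<noteq> l \<Longrightarrow> j \<noteq> l \<Longrightarrow>
      card (A i \<inter> A j \<inter> A l) \<le> c"
  shows "card (\<Union>i\<in>I. A i) + b + (card I - 2) * (2 * b) \<le> card I * a + (card I - 2) * c"
proof -
  obtain J where J: "J \<subseteq> I" "card J = 2" using obtain_subset_with_card_n [OF assms(2)] by metis
  then obtain i j where ij: "i \<in> I" "j \<in> I" "i \<noteq> j" "J = {i, j}" by (auto simp: card_2_iff)
  let ?K = "I - {i, j}" and ?D = "A i \<union> A j"
  have cK: "card ?K = card I - 2" using J ij assms(1) by (simp add: card_Diff_subset)
  have finD: "finite ?D" using fin ij by auto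
  have cD: "card ?D + b = 2 * a"
    using card_Un_Int [of "A i" "A j"] fin a b ij by simp
  have step: "card (A l - ?D) + 2 * b \<le> a + c" if "l \<in> ?K" for l
  proof -
    have l: "l \<in> I" "l \<noteq> i" "l \<noteq> j" using that by auto
    have "card (A l - ?D) + card (A l \<inter> ?D) = a"
      using card_Diff_subset_Int [of "A l" ?D] fin a l finD
      by (metis Diff_Int_distrib2 add.commute card_Int_Diff)
    moreover have "card (A l \<inter> A i) + card (A l \<inter> A j) = card (A l \<inter> ?D) + card (A i \<inter> A j \<inter> A l)"
    proof -
      have "(A l \<inter> A i) \<union> (A l \<inter> A j) = A l \<inter> ?D" "(A l \<inter> A i) \<inter> (A l \<inter> A j) = A i \<inter> A j \<inter> A l"
        by auto
      then show ?thesis using card_Un_Int [of "A l \<inter> A i" "A l \<inter> A j"] fin l by simp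
    qed
    moreover have "card (A i \<inter> A j \<inter> A l) \<le> c" using c ij l by auto
    moreover have "card (A l \<inter> A i) = b" "card (A l \<inter> A j) = b" using b ij l by auto
    ultimately show ?thesis by linarith
  qed
  have "(\<Sum>l\<in>?K. card (A l - ?D) + 2 * b) \<le> (\<Sum>l\<in>?K. a + c)" by (intro sum_mono step)
  then have sum: "(\<Sum>l\<in>?K. card (A l - ?D)) + (card I - 2) * (2 * b) \<le> (card I - 2) * (a + c)"
    by (simp add: sum.distrib cK)
  have "(\<Union>l\<in>I. A l) = ?D \<union> (\<Union>l\<in>?K. A l - ?D)" using ij by auto
  then have "card (\<Union>l\<in>I. A l) \<le> card ?D + card (\<Union>l\<in>?K. A l - ?D)"
    using card_Un_le [of ?D "\<Union>l\<in>?K. A l - ?D"] by argo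
  also have "card (\<Union>l\<in>?K. A l - ?D) \<le> (\<Sum>l\<in>?K. card (A l - ?D))"
    using assms(1) by (intro card_UN_le) auto
  finally have "card (\<Union>l\<in>I. A l) + b + (card I - 2) * (2 * b) \<le> 2 * a + (card I - 2) * (a + c)"
    using cD sum by linarith
  also have "\<dots> = (2 + (card I - 2)) * a + (card I - 2) * c" by (simp only: add_mult_distrib add_mult_distrib2)
  also have "2 + (card I - 2) = card I" using assms(2) by simp
  finally show ?thesis .
qed

section \<open>Lower bounds for the two candidate families\<close>

lemma star_Int: "star n r k S \<inter> star n r k S' = star n r k (S \<union> S')"
  by (auto simp: star_def)

context signed_parameters
begin

text \<open>The members containing \<open>M t\<close> and some point of \<open>M l - M t\<close> already suffice for this bound.\<close>

lemma card_H1_ge: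
  assumes "t + 2 \<le> l" "l \<le> n"
  shows "(l - t) * N (t + 1) \<le> card (H1 n r k l t) + ((l - t) choose 2) * N (t + 2)"
proof -
  let ?I = "M l - M t" and ?A = "\<lambda>z. star n r k (insert z (M t))"
  have Ml: "M l \<in> signed_sets n l k" using assms k_ge by (intro M_signed) auto
  have MM: "M t \<subseteq> M l" using assms by (intro M_mono) auto
  have cI: "card ?I = l - t" using MM by (simp add: card_Diff_subset)
  have sub: "(\<Union>z\<in>?I. ?A z) \<subseteq> H1 n r k l t"
  proof
    fix F assume "F \<in> (\<Union>z\<in>?I. ?A z)"
    then obtain z where z: "z \<in> ?I" "F \<in> signed_sets n r k" "insert z (M t) \<subseteq> F"
      by (auto simp: star_def)
    then have "card (insert z (M t)) \<le> card (F \<inter> M l)" using MM by (intro card_mono) auto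
    then show "F \<in> H1 n r k l t" using z by (simp add: H1_def)
  qed
  have "card ?I * N (t + 1) \<le> card (\<Union>z\<in>?I. ?A z) + (card ?I choose 2) * N (t + 2)"
  proof (rule card_UN_Bonferroni)
    show "N (t + 1) \<le> card (?A z)" if "z \<in> ?I" for z
      using that card_star [OF signed_sets_subset [OF Ml, of "insert z (M t)"], of r] MM by simp
    show "card (?A z \<inter> ?A w) \<le> N (t + 2)" if "z \<in> ?I" "w \<in> ?I" "z \<noteq> w" for z w
      using that card_star [OF signed_sets_subset [OF Ml, of "insert z (M t) \<union> insert w (M t)"], of r] MM
      by (simp add: star_Int)
  qed auto
  also have "card (\<Union>z\<in>?I. ?A z) \<le> card (H1 n r k l t)"
    using sub finite_H1 by (rule card_mono [rotated])
  finally show ?thesis unfolding cI by simp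
qed

text \<open>All \<open>r\<close>-sets meeting \<open>M (t + 2)\<close> in at least \<open>t + 1\<close> points belong to the family. They are the
  disjoint union of the star of \<open>M (t + 2)\<close> and, for each point \<open>p\<close> of \<open>M (t + 2)\<close>, of the
  \<open>N (t + 1) - N (t + 2)\<close> sets containing \<open>M (t + 2) - {p}\<close> but not \<open>p\<close>.\<close>

lemma card_H1_small_ge: "(t + 2) * N (t + 1) \<le> card (H1 n r k (t + 2) t) + (t + 1) * N (t + 2)"
proof -
  let ?Z = "M (t + 2)"
  let ?D = "star n r k ?Z" and ?A = "\<lambda>p. star n r k (?Z - {p})"
  have Z: "?Z \<in> signed_sets n (t + 2) k" using n_ge k_ge by (intro M_signed) auto
  have cD: "card ?D = N (t + 2)" using Z by (rule card_star)
  have cA: "card (?A p - ?D) + N (t + 2) = N (t + 1)" if "p \<in> ?Z" for p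
  proof -
    have "card (?A p) = N (t + 1)"
      using that card_star [OF signed_sets_subset [OF Z, of "?Z - {p}"], of r] by simp
    moreover have "?D \<subseteq> ?A p" by (intro star_mono) auto
    ultimately show ?thesis using cD card_Diff_subset [of ?D "?A p"] card_mono [of "?A p" ?D] by simp
  qed
  have "(\<Sum>p\<in>?Z. card (?A p - ?D) + N (t + 2)) = (\<Sum>p\<in>?Z. N (t + 1))" by (intro sum.cong cA refl)
  then have sum: "(\<Sum>p\<in>?Z. card (?A p - ?D)) + (t + 2) * N (t + 2) = (t + 2) * N (t + 1)"
    by (simp add: sum.distrib)
  have "card (?D \<union> (\<Union>p\<in>?Z. ?A p - ?D)) = card ?D + card (\<Union>p\<in>?Z. ?A p - ?D)"
    by (intro card_Un_disjoint) auto
  also have "card (\<Union>p\<in>?Z. ?A p - ?D) = (\<Sum>p\<in>?Z. card (?A p - ?D))"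
  proof (intro card_UN_disjoint ballI impI)
    fix p q assume "p \<in> ?Z" "q \<in> ?Z" "p \<noteq> q"
    then have "(?Z - {p}) \<union> (?Z - {q}) = ?Z" by auto
    then have "?A p \<inter> ?A q = ?D" by (simp add: star_Int)
    then show "(?A p - ?D) \<inter> (?A q - ?D) = {}" by auto
  qed auto
  finally have "card (?D \<union> (\<Union>p\<in>?Z. ?A p - ?D)) = N (t + 2) + (\<Sum>p\<in>?Z. card (?A p - ?D))"
    using cD by simp
  moreover have "?D \<union> (\<Union>p\<in>?Z. ?A p - ?D) \<subseteq> H1 n r k (t + 2) t"
  proof
    fix F assume "F \<in> ?D \<union> (\<Union>p\<in>?Z. ?A p - ?D)"
    then have "F \<in> ?D \<or> (\<exists>p\<in>?Z. F \<in> ?A p)" by blast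
    then obtain S where F: "F \<in> signed_sets n r k" and S: "S \<subseteq> F" "S \<subseteq> ?Z" "t + 1 \<le> card S"
    proof (elim disjE bexE)
      assume "F \<in> ?D"
      then show thesis by (intro that [of ?Z]) (auto simp: star_def)
    next
      fix p assume "p \<in> ?Z" "F \<in> ?A p"
      then show thesis by (intro that [of "?Z - {p}"]) (simp_all add: star_def)
    qed
    have "card S \<le> card (F \<inter> ?Z)" using S by (intro card_mono) auto
    moreover have "M t \<subseteq> F" if "card (F \<inter> ?Z) \<noteq> t + 1"
    proof -
      have "card (F \<inter> ?Z) \<le> card ?Z" by (intro card_mono) auto
      then have "F \<inter> ?Z = ?Z"
        using that S(3) \<open>card S \<le> card (F \<inter> ?Z)\<close> by (intro card_subset_eq) auto
      then show ?thesis using M_mono [of t "t + 2"] by auto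
    qed
    ultimately show "F \<in> H1 n r k (t + 2) t" using F S(3) by (auto simp: H1_def)
  qed
  ultimately have "N (t + 2) + (\<Sum>p\<in>?Z. card (?A p - ?D)) \<le> card (H1 n r k (t + 2) t)"
    using finite_H1 by (metis card_mono)
  then show ?thesis using sum by simp
qed

end

section \<open>Families without covers of size \<open>t + 1\<close>, and triangles of covers\<close>

context largest_family
begin

text \<open>Here the smallest covers have at least \<open>t + 2\<close> points.\<close>

lemma card_family_no_covers:
  assumes "covers = {}"
  shows "card \<F> \<le> ((t + 2) choose 2) * (v ^ 2 * N (t + 2))"
proof -
  let ?P = "\<lambda>s. \<exists>S\<in>signed_sets n s k. t_cover t \<F> S"
  define \<tau> where "\<tau> = (LEAST s. ?P s)"
  have "\<F> \<noteq> {}"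
    using family_nontrivial M_signed [of t n k] n_ge k_ge by (auto simp: trivial_family_def)
  then obtain F where "F \<in> \<F>" by blast
  then have "?P r"
    using family_inter family_sub by (auto simp: t_cover_def t_intersecting_def)
  then have "?P \<tau>" unfolding \<tau>_def by (rule LeastI)
  then obtain T where T: "T \<in> signed_sets n \<tau> k" "t_cover t \<F> T" by blast
  have no_cover: "\<not> t_cover t \<F> S" if "s < \<tau>" "S \<in> signed_sets n s k" for s S
    using not_less_Least [of s ?P] that unfolding \<tau>_def by blast
  have "\<tau> \<noteq> t + 1" using T assms by (auto simp: covers_def)
  moreover have "\<not> \<tau> < t + 1" using no_small_cover [OF _ T(1)] T(2) by blast
  ultimately have "t + 2 \<le> \<tau>" by simp
  have "card \<F> \<le> (\<tau> choose t) * (v ^ (\<tau> - t) * N \<tau>)"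
    unfolding v_def using \<open>t + 2 \<le> \<tau>\<close>
    by (intro card_le_min_cover [OF family_sub family_inter no_cover T]) auto
  also have "\<dots> \<le> ((t + 2) choose 2) * (v ^ 2 * N (t + 2))"
    using \<open>t + 2 \<le> \<tau>\<close> by (rule choose_star_size_antimono)
  finally show ?thesis .
qed

lemma card_family_star_le:
  assumes "S \<in> signed_sets n s k" "\<G> \<subseteq> \<F>"
  shows "card {F \<in> \<G>. S \<subseteq> F} \<le> N s"
proof -
  have "{F \<in> \<G>. S \<subseteq> F} \<subseteq> star n r k S" using assms family_sub by (auto simp: star_def)
  then show ?thesis using card_star [OF assms(1)] by (metis card_mono finite_star)
qed

lemma card_non_cover_le:
  assumes "S \<in> signed_sets n s k" "t \<le> s" "\<not> t_cover t \<F> S" "\<G> \<subseteq> \<F>"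
  shows "card {F \<in> \<G>. S \<subseteq> F} \<le> v * N (Suc s)"
  unfolding v_def using assms(4)
  by (intro card_le_branching [OF family_sub family_inter assms] card_family_star_le)

text \<open>The crude bound from the stars of the \<open>t + 2\<close> subsets of \<open>Z\<close> of size \<open>t + 1\<close>.\<close>

lemma card_family_triangle:
  assumes Z: "Z \<in> signed_sets n (t + 2) k" and "\<And>F. F \<in> \<F> \<Longrightarrow> t + 1 \<le> card (F \<inter> Z)"
  shows "card \<F> \<le> (t + 2) * N (t + 1)"
proof -
  note ZD = signed_setsD [OF Z]
  have "\<F> \<subseteq> (\<Union>p\<in>Z. star n r k (Z - {p}))"
  proof
    fix F assume F: "F \<in> \<F>"
    have "card (Z - F) \<le> 1"
      using assms(2) [OF F] card_Diff_subset_Int [of Z F] ZD by (simp add: Int_commute)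
    have "\<exists>p\<in>Z. Z - F \<subseteq> {p}"
    proof (cases "Z - F = {}")
      case True
      then show ?thesis using ZD(3) by (metis card.empty add_is_0 empty_subsetI ex_in_conv zero_neq_numeral)
    next
      case False
      then have "card (Z - F) = 1" using \<open>card (Z - F) \<le> 1\<close> ZD(4) by (simp add: le_Suc_eq)
      then show ?thesis by (auto simp: card_1_singleton_iff)
    qed
    then obtain p where "p \<in> Z" "Z - F \<subseteq> {p}" by blast
    then show "F \<in> (\<Union>p\<in>Z. star n r k (Z - {p}))"
      using F family_sub by (auto simp: star_def)
  qed
  then have "card \<F> \<le> card (\<Union>p\<in>Z. star n r k (Z - {p}))" using ZD by (intro card_mono) auto
  also have "\<dots> \<le> (\<Sum>p\<in>Z. card (star n r k (Z - {p})))" using ZD by (intro card_UN_le)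
  also have "\<dots> = (\<Sum>p\<in>Z. N (t + 1))"
  proof (intro sum.cong refl)
    fix p assume "p \<in> Z"
    then show "card (star n r k (Z - {p})) = N (t + 1)"
      using card_star [OF signed_sets_subset [OF Z, of "Z - {p}"], of r] ZD by simp
  qed
  finally show ?thesis using ZD by simp
qed

lemma triangle_subset_hm_family:
  assumes Z: "Z \<in> signed_sets n (t + 2) k" and "\<And>F. F \<in> \<F> \<Longrightarrow> t + 1 \<le> card (F \<inter> Z)"
    and "E \<subseteq> Z"
  shows "\<F> \<subseteq> hm_family n r k t E Z"
proof
  fix F assume F: "F \<in> \<F>"
  note ZD = signed_setsD [OF Z]
  have "card (F \<inter> Z) = t + 1" if "\<not> E \<subseteq> F"
  proof -
    have "F \<inter> Z \<subset> Z" using that \<open>E \<subseteq> Z\<close> by auto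
    then have "card (F \<inter> Z) < t + 2" using ZD psubset_card_mono [of Z "F \<inter> Z"] by simp
    then show ?thesis using assms(2) [OF F] by simp
  qed
  then show "F \<in> hm_family n r k t E Z"
    using F assms(2) family_sub ZD(3) by (auto simp: hm_family_def)
qed

end

section \<open>Families whose covers form a star\<close>

text \<open>A largest family whose covers of size \<open>t + 1\<close> exist and all contain the \<open>t\<close>-set \<open>E\<close>. If there
  is only one cover, any of its \<open>t\<close>-subsets may serve as \<open>E\<close>.\<close>

locale star_of_covers = largest_family +
  fixes E :: "(nat \<times> nat) set"
  assumes E: "E \<in> signed_sets n t k" and covers_E: "T \<in> covers \<Longrightarrow> E \<subseteq> T"
    and covers_ne: "covers \<noteq> {}"
begin

text \<open>The points that extend \<open>E\<close> to a cover.\<close>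

definition Y :: "(nat \<times> nat) set" where "Y = {z. z \<notin> E \<and> insert z E \<in> covers}"

text \<open>The number of covers of size \<open>t + 1\<close>.\<close>

definition m :: nat where "m = card Y"

lemma ED: "E \<subseteq> {1..n} \<times> {1..k}" "inj_on fst E" "card E = t" "finite E"
  using signed_setsD [OF E] by auto

lemma covers_iff: "T \<in> covers \<longleftrightarrow> (\<exists>z\<in>Y. T = insert z E)"
proof
  assume T: "T \<in> covers"
  then have "E \<subseteq> T" by (rule covers_E)
  then have "card (T - E) = 1" using coversD(2) [OF T] ED by (simp add: card_Diff_subset)
  then obtain z where "T - E = {z}" by (auto simp: card_1_singleton_iff)
  then have "T = insert z E" "z \<notin> E" using \<open>E \<subseteq> T\<close> by auto
  then show "\<exists>z\<in>Y. T = insert z E" using T by (intro bexI [of _ z]) (simp_all add: Y_def)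
qed (auto simp: Y_def)

lemma Y_ne: "Y \<noteq> {}" using covers_ne covers_iff by blast

text \<open>A member missing a point of \<open>E\<close> meets each cover \<open>insert z E\<close> in \<open>t\<close> points, hence in all
  points but one.\<close>

lemma not_containing_E:
  assumes F: "F \<in> \<F>" "\<not> E \<subseteq> F"
  shows "Y \<subseteq> F" "card (F \<inter> E) = t - 1"
proof -
  have "F \<inter> E \<subset> E" using F(2) by auto
  then have lt: "card (F \<inter> E) < t" using psubset_card_mono [of E "F \<inter> E"] ED by simp
  have *: "z \<in> F \<and> card (F \<inter> E) = t - 1" if "z \<in> Y" for z
  proof -
    have "t \<le> card (F \<inter> insert z E)" using F(1) that covers_iff coversD(5) by blast
    also have "\<dots> = (if z \<in> F then Suc (card (F \<inter> E)) else card (F \<inter> E))"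
      using that ED(4) by (auto simp: Y_def)
    finally show ?thesis using lt by (auto split: if_splits)
  qed
  then show "Y \<subseteq> F" by blast
  show "card (F \<inter> E) = t - 1" using * Y_ne by blast
qed

lemma ex_not_containing_E: "\<exists>F\<in>\<F>. \<not> E \<subseteq> F"
  using family_nontrivial E by (auto simp: trivial_family_def)

lemma finite_Y: "finite Y"
proof -
  obtain F where F: "F \<in> \<F>" "\<not> E \<subseteq> F" using ex_not_containing_E by blast
  show ?thesis by (rule finite_subset [OF not_containing_E(1) [OF F] familyD(4) [OF F(1)]])
qed

lemma m_ge: "1 \<le> m" using Y_ne finite_Y by (simp add: m_def Suc_le_eq card_gt_0_iff)

lemma fst_Y_notin: "z \<in> Y \<Longrightarrow> fst z \<notin> fst ` E"
  using fst_notin_if_insert_signed [of z E n "t + 1" k] by (auto simp: Y_def covers_def)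

text \<open>The union is a signed set because \<open>Y\<close> lies in a member and each \<open>insert z E\<close> is a signed set.\<close>

lemma E_Un_Y: "E \<union> Y \<in> signed_sets n (t + m) k"
proof -
  obtain F where F: "F \<in> \<F>" "\<not> E \<subseteq> F" using ex_not_containing_E by blast
  have YF: "Y \<subseteq> F" using not_containing_E(1) [OF F] .
  have "inj_on fst Y" using YF familyD(2) [OF F(1)] by (rule inj_on_subset [rotated])
  moreover have "fst ` E \<inter> fst ` Y = {}"
  proof (rule equals0I)
    fix x assume x: "x \<in> fst ` E \<inter> fst ` Y"
    from IntD2 [OF x] obtain z where "x = fst z" "z \<in> Y" by (rule imageE)
    then show False using IntD1 [OF x] fst_Y_notin [of z] by metis
  qed
  ultimately have "inj_on fst (E \<union> Y)"
    using ED(2) unfolding inj_on_Un by blast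
  moreover have "E \<union> Y \<subseteq> {1..n} \<times> {1..k}"
    using ED(1) YF signed_setsD(1) [OF familyD(1) [OF F(1)]] by blast
  moreover have "card (E \<union> Y) = t + m"
    using ED finite_Y by (subst card_Un_disjoint) (auto simp: m_def Y_def)
  ultimately show ?thesis by (simp add: signed_sets_altdef)
qed

text \<open>Take the points with coordinates outside \<open>E\<close> in a member \<open>F0\<close> not containing \<open>E\<close>. At most
  \<open>r - (t - 1)\<close> points of \<open>F0\<close> lie outside \<open>E\<close>, and members containing \<open>E\<close> meet \<open>F0\<close> in more
  than its \<open>t - 1\<close> points in \<open>E\<close>.\<close>

lemma hitting_set:
  obtains G where "finite G" "Y \<subseteq> G" "card G \<le> v"
    "\<And>F. F \<in> \<F> \<Longrightarrow> E \<subseteq> F \<Longrightarrow> F \<inter> G \<noteq> {}"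
    "\<And>w. w \<in> G \<Longrightarrow> w \<notin> E \<and> insert w E \<in> signed_sets n (t + 1) k"
proof -
  obtain F0 where F0: "F0 \<in> \<F>" "\<not> E \<subseteq> F0" using ex_not_containing_E by blast
  note FD = signed_setsD [OF familyD(1) [OF F0(1)]]
  define G where "G = {w \<in> F0. fst w \<notin> fst ` E}"
  have finG: "finite G" using FD(4) by (simp add: G_def)
  have YG: "Y \<subseteq> G" using not_containing_E(1) [OF F0] fst_Y_notin by (auto simp: G_def)
  have "card G \<le> card (F0 - F0 \<inter> E)" using FD(4) by (intro card_mono) (auto simp: G_def)
  also have "\<dots> = r - (t - 1)"
    using not_containing_E(2) [OF F0] FD by (simp add: card_Diff_subset)
  finally have c1: "card G \<le> r - (t - 1)" .
  have "inj_on fst G" using FD(2) by (rule inj_on_subset) (auto simp: G_def)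
  then have "card G = card (fst ` G)" by (simp add: card_image)
  also have "\<dots> \<le> card ({1..n} - fst ` E)"
    using FD(1) by (intro card_mono) (auto simp: G_def)
  also have "\<dots> = n - t"
    using ED by (subst card_Diff_subset) (auto simp: card_image)
  finally have "card G \<le> v" using c1 t_ge r_ge by (simp add: v_def)
  moreover have "F \<inter> G \<noteq> {}" if F: "F \<in> \<F>" "E \<subseteq> F" for F
  proof
    assume "F \<inter> G = {}"
    have "F \<inter> F0 \<subseteq> F0 \<inter> E"
    proof
      fix w assume w: "w \<in> F \<inter> F0"
      then have "w \<notin> G" using \<open>F \<inter> G = {}\<close> by auto
      then have "fst w \<in> fst ` E" using w by (auto simp: G_def)
      then obtain e where e: "e \<in> E" "fst w = fst e" by auto
      then have "w = e" using w F(2) by (intro inj_onD [OF familyD(2) [OF F(1)]]) auto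
      then show "w \<in> F0 \<inter> E" using w e by simp
    qed
    then have "card (F \<inter> F0) \<le> card (F0 \<inter> E)" using FD(4) by (intro card_mono) auto
    moreover have "t \<le> card (F \<inter> F0)"
      using family_inter F F0 by (auto simp: t_intersecting_def)
    ultimately show False using not_containing_E(2) [OF F0] t_ge by simp
  qed
  moreover have "w \<notin> E \<and> insert w E \<in> signed_sets n (t + 1) k" if "w \<in> G" for w
  proof -
    have "fst w \<in> {1..n}" "snd w \<in> {1..k}" "fst w \<notin> fst ` E"
      using that FD(1) by (auto simp: G_def)
    then show ?thesis using signed_sets_insert [OF E, of "fst w" "snd w"] by auto
  qed
  ultimately show thesis using finG YG by (intro that [of G]) auto
qed

lemma m_le: "m \<le> v"
proof -
  obtain G where "finite G" "Y \<subseteq> G" "card G \<le> v" using hitting_set by metis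
  then show ?thesis unfolding m_def by (meson card_mono order_trans)
qed

lemma not_cover_if_not_E:
  assumes "S \<in> signed_sets n (t + 1) k" "\<not> E \<subseteq> S"
  shows "\<not> t_cover t \<F> S"
  using assms covers_E [of S] by (auto simp: covers_def)

text \<open>Such a member hits a point \<open>w\<close> of the hitting set outside \<open>Y\<close>, and then \<open>insert w E\<close> is not a
  cover, which allows one more branching.\<close>

lemma card_E_not_Y: "card {F \<in> \<F>. E \<subseteq> F \<and> Y \<inter> F = {}} \<le> (v - m) * (v * N (t + 2))"
proof -
  obtain G where G: "finite G" "Y \<subseteq> G" "card G \<le> v"
    "\<And>F. F \<in> \<F> \<Longrightarrow> E \<subseteq> F \<Longrightarrow> F \<inter> G \<noteq> {}"
    "\<And>w. w \<in> G \<Longrightarrow> w \<notin> E \<and> insert w E \<in> signed_sets n (t + 1) k"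
    by (rule hitting_set) blast
  have "{F \<in> \<F>. E \<subseteq> F \<and> Y \<inter> F = {}} \<subseteq> (\<Union>w\<in>G - Y. {F \<in> \<F>. insert w E \<subseteq> F})"
    using G(4) by fastforce
  then have "card {F \<in> \<F>. E \<subseteq> F \<and> Y \<inter> F = {}} \<le> card (\<Union>w\<in>G - Y. {F \<in> \<F>. insert w E \<subseteq> F})"
    using G(1) finite_family by (intro card_mono) auto
  also have "\<dots> \<le> (\<Sum>w\<in>G - Y. card {F \<in> \<F>. insert w E \<subseteq> F})"
    using G(1) by (intro card_UN_le) auto
  also have "\<dots> \<le> (\<Sum>w\<in>G - Y. v * N (t + 2))"
  proof (rule sum_mono)
    fix w assume w: "w \<in> G - Y"
    then have S: "insert w E \<in> signed_sets n (t + 1) k" "w \<notin> E" using G(5) by auto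
    then have "insert w E \<notin> covers" using w by (auto simp: Y_def)
    then have "\<not> t_cover t \<F> (insert w E)" using S by (simp add: covers_def)
    then show "card {F \<in> \<F>. insert w E \<subseteq> F} \<le> v * N (t + 2)"
      using card_non_cover_le [OF S(1) _ _ subset_refl] by simp
  qed
  also have "\<dots> = card (G - Y) * (v * N (t + 2))" by simp
  also have "card (G - Y) = card G - m" unfolding m_def using G(2) finite_Y by (intro card_Diff_subset)
  also have "(card G - m) * (v * N (t + 2)) \<le> (v - m) * (v * N (t + 2))"
    using G(3) by (intro mult_le_mono) auto
  finally show ?thesis .
qed

lemma E_and_Y_subset:
  "{F \<in> \<F>. E \<subseteq> F \<and> Y \<inter> F \<noteq> {}} \<subseteq> (\<Union>z\<in>Y. star n r k (insert z E))"
  using family_sub by (auto simp: star_def)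

lemma card_star_E_Un:
  assumes "A \<subseteq> Y" "finite A"
  shows "card (star n r k (A \<union> E)) = N (t + card A)"
proof -
  have "card (A \<union> E) = t + card A"
    using assms ED by (subst card_Un_disjoint) (auto simp: Y_def)
  moreover have "A \<union> E \<subseteq> E \<union> Y" using assms by auto
  ultimately show ?thesis using card_star [OF signed_sets_subset [OF E_Un_Y, of "A \<union> E"]] by simp
qed

lemma card_E_and_Y: "card {F \<in> \<F>. E \<subseteq> F \<and> Y \<inter> F \<noteq> {}} \<le> m * N (t + 1)"
proof -
  have "card {F \<in> \<F>. E \<subseteq> F \<and> Y \<inter> F \<noteq> {}} \<le> card (\<Union>z\<in>Y. star n r k (insert z E))"
    using finite_Y by (intro card_mono E_and_Y_subset) auto
  also have "\<dots> \<le> (\<Sum>z\<in>Y. card (star n r k (insert z E)))" using finite_Y by (rule card_UN_le)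
  also have "\<dots> = (\<Sum>z\<in>Y. N (t + 1))"
    using card_star_E_Un [of "{z}" for z] by (intro sum.cong) auto
  finally show ?thesis by (simp add: m_def)
qed

text \<open>This second-order bound is needed only for \<open>m = v = t + 2\<close>, where the leading term
  \<open>m * N (t + 1)\<close> agrees with that of the benchmark.\<close>

lemma card_E_and_Y_refined:
  assumes "2 \<le> m"
  shows "card {F \<in> \<F>. E \<subseteq> F \<and> Y \<inter> F \<noteq> {}} + N (t + 2) + (m - 2) * (2 * N (t + 2))
    \<le> m * N (t + 1) + (m - 2) * N (t + 3)"
proof -
  have "card {F \<in> \<F>. E \<subseteq> F \<and> Y \<inter> F \<noteq> {}} \<le> card (\<Union>z\<in>Y. star n r k (insert z E))"
    using finite_Y by (intro card_mono E_and_Y_subset) auto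
  moreover have "card (\<Union>z\<in>Y. star n r k (insert z E)) + N (t + 2) + (m - 2) * (2 * N (t + 2))
    \<le> m * N (t + 1) + (m - 2) * N (t + 3)"
    unfolding m_def
  proof (rule card_UN_triple_bound)
    show "2 \<le> card Y" using assms by (simp add: m_def)
    show "card (star n r k (insert x E)) = N (t + 1)" if "x \<in> Y" for x
      using card_star_E_Un [of "{x}"] that by simp
    show "card (star n r k (insert x E) \<inter> star n r k (insert y E)) = N (t + 2)"
      if "x \<in> Y" "y \<in> Y" "x \<noteq> y" for x y
      using card_star_E_Un [of "{x, y}"] that by (simp add: star_Int insert_commute)
    show "card (star n r k (insert x E) \<inter> star n r k (insert y E) \<inter> star n r k (insert z E)) \<le> N (t + 3)"
      if "x \<in> Y" "y \<in> Y" "z \<in> Y" "x \<noteq> y" "x \<noteq> z" "y \<noteq> z" for x y z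
      using card_star_E_Un [of "{x, y, z}"] that by (simp add: star_Int insert_commute eval_nat_numeral)
  qed (use finite_Y in auto)
  ultimately show ?thesis by linarith
qed

lemma card_not_E_le:
  assumes b: "\<And>e. e \<in> E \<Longrightarrow> card {F \<in> {F \<in> \<F>. \<not> E \<subseteq> F}. (E - {e}) \<union> Y \<subseteq> F} \<le> b"
  shows "card {F \<in> \<F>. \<not> E \<subseteq> F} \<le> t * b"
proof -
  let ?R = "{F \<in> \<F>. \<not> E \<subseteq> F}"
  have "?R \<subseteq> (\<Union>e\<in>E. {F \<in> ?R. (E - {e}) \<union> Y \<subseteq> F})"
  proof
    fix F assume F: "F \<in> ?R"
    then have FF: "F \<in> \<F>" "\<not> E \<subseteq> F" by auto
    have "card (E - F) = 1"
      using not_containing_E(2) [OF FF] card_Diff_subset_Int [of E F] ED t_ge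
      by (simp add: Int_commute)
    then obtain e where "E - F = {e}" by (auto simp: card_1_singleton_iff)
    then show "F \<in> (\<Union>e\<in>E. {F \<in> ?R. (E - {e}) \<union> Y \<subseteq> F})"
      using F not_containing_E(1) [OF FF] by auto
  qed
  then have "card ?R \<le> card (\<Union>e\<in>E. {F \<in> ?R. (E - {e}) \<union> Y \<subseteq> F})"
    using ED(4) finite_family by (intro card_mono) auto
  also have "\<dots> \<le> (\<Sum>e\<in>E. card {F \<in> ?R. (E - {e}) \<union> Y \<subseteq> F})"
    using ED(4) by (rule card_UN_le)
  also have "\<dots> \<le> (\<Sum>e\<in>E. b)" by (intro sum_mono b)
  finally show ?thesis using ED by simp
qed

lemma E_minus_Un_Y:
  assumes "e \<in> E"
  shows "(E - {e}) \<union> Y \<in> signed_sets n (t - 1 + m) k" "\<not> E \<subseteq> (E - {e}) \<union> Y"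
proof -
  have "card ((E - {e}) \<union> Y) = t - 1 + m"
    using assms ED finite_Y by (subst card_Un_disjoint) (auto simp: m_def Y_def)
  then show "(E - {e}) \<union> Y \<in> signed_sets n (t - 1 + m) k"
    using signed_sets_subset [OF E_Un_Y, of "(E - {e}) \<union> Y"] by auto
  show "\<not> E \<subseteq> (E - {e}) \<union> Y" using assms by (auto simp: Y_def)
qed

text \<open>The signed set \<open>(E - {e}) \<union> Y\<close> has \<open>t - 1 + m\<close> points. For \<open>m \<ge> 3\<close> counting its star suffices;
  for \<open>m = 2\<close> and \<open>m = 1\<close> it is too small, and one or two branchings bring it to size \<open>t + 2\<close>.\<close>

lemma card_not_E: "card {F \<in> \<F>. \<not> E \<subseteq> F} \<le> t * N (t - 1 + m)"
  by (intro card_not_E_le card_family_star_le E_minus_Un_Y) auto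

lemma card_not_E_2:
  assumes "m = 2"
  shows "card {F \<in> \<F>. \<not> E \<subseteq> F} \<le> t * (v * N (t + 2))"
proof (rule card_not_E_le)
  fix e assume e: "e \<in> E"
  have "t - 1 + m = t + 1" using assms t_ge by simp
  then have S: "(E - {e}) \<union> Y \<in> signed_sets n (t + 1) k" using E_minus_Un_Y(1) [OF e] by simp
  show "card {F \<in> {F \<in> \<F>. \<not> E \<subseteq> F}. (E - {e}) \<union> Y \<subseteq> F} \<le> v * N (t + 2)"
    using not_cover_if_not_E [OF S E_minus_Un_Y(2) [OF e]]
      card_non_cover_le [OF S, of "{F \<in> \<F>. \<not> E \<subseteq> F}"] by simp
qed

lemma card_not_E_1:
  assumes "m = 1"
  shows "card {F \<in> \<F>. \<not> E \<subseteq> F} \<le> t * (v * (v * N (t + 2)))"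
proof (rule card_not_E_le)
  fix e assume e: "e \<in> E"
  let ?R = "{F \<in> \<F>. \<not> E \<subseteq> F}" and ?S = "(E - {e}) \<union> Y"
  have S: "?S \<in> signed_sets n t k" using E_minus_Un_Y(1) [OF e] assms t_ge by simp
  have "card {F \<in> ?R. insert w ?S \<subseteq> F} \<le> v * N (t + 2)"
    if w: "insert w ?S \<in> signed_sets n (Suc t) k" for w
  proof (cases "w = e")
    case True
    \<comment> \<open>Here \<open>insert w ?S\<close> is a cover, but it contains \<open>E\<close>.\<close>
    then have "{F \<in> ?R. insert w ?S \<subseteq> F} = {}" using e by auto
    then show ?thesis by (metis card.empty zero_le)
  next
    case False
    then have "\<not> E \<subseteq> insert w ?S" using E_minus_Un_Y(2) [OF e] e by auto
    then have "\<not> t_cover t \<F> (insert w ?S)" using w by (intro not_cover_if_not_E) auto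
    then show ?thesis using card_non_cover_le [OF w, of ?R] by simp
  qed
  then show "card {F \<in> ?R. ?S \<subseteq> F} \<le> v * (v * N (t + 2))"
    by (intro card_le_branching [OF family_sub family_inter S, folded v_def] no_small_cover [OF _ S]) auto
qed

lemma card_family_split:
  "card \<F> = card {F \<in> \<F>. E \<subseteq> F \<and> Y \<inter> F \<noteq> {}} + card {F \<in> \<F>. E \<subseteq> F \<and> Y \<inter> F = {}}
    + card {F \<in> \<F>. \<not> E \<subseteq> F}"
proof -
  let ?P = "{F \<in> \<F>. E \<subseteq> F \<and> Y \<inter> F \<noteq> {}}" and ?Q = "{F \<in> \<F>. E \<subseteq> F \<and> Y \<inter> F = {}}"
    and ?R = "{F \<in> \<F>. \<not> E \<subseteq> F}"
  have "\<F> = (?P \<union> ?Q) \<union> ?R" by auto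
  then have "card \<F> = card ((?P \<union> ?Q) \<union> ?R)" by simp
  also have "\<dots> = card (?P \<union> ?Q) + card ?R" using finite_family by (intro card_Un_disjoint) auto
  also have "card (?P \<union> ?Q) = card ?P + card ?Q" using finite_family by (intro card_Un_disjoint) auto
  finally show ?thesis .
qed

text \<open>For \<open>m = v\<close> the bound in \<open>card_E_not_Y\<close> is zero.\<close>

lemma star_subset_hm_family:
  assumes "m = v"
  shows "\<F> \<subseteq> hm_family n r k t E (E \<union> Y)"
proof
  fix F assume F: "F \<in> \<F>"
  note FD = familyD [OF F]
  show "F \<in> hm_family n r k t E (E \<union> Y)"
  proof (cases "E \<subseteq> F")
    case True
    have "card {F \<in> \<F>. E \<subseteq> F \<and> Y \<inter> F = {}} = 0" using card_E_not_Y assms by simp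
    then have "{F \<in> \<F>. E \<subseteq> F \<and> Y \<inter> F = {}} = {}" using finite_family by simp
    then obtain z where z: "z \<in> Y" "z \<in> F" using F True by blast
    then have "card (insert z E) \<le> card (F \<inter> (E \<union> Y))"
      using True FD(4) by (intro card_mono) auto
    moreover have "card (insert z E) = t + 1" using z ED by (simp add: Y_def)
    ultimately show ?thesis using True FD by (simp add: hm_family_def)
  next
    case False
    have "F \<inter> (E \<union> Y) = (F \<inter> E) \<union> Y" using not_containing_E(1) [OF F False] by auto
    moreover have "card ((F \<inter> E) \<union> Y) = card (F \<inter> E) + m"
      unfolding m_def using finite_Y ED(4) by (intro card_Un_disjoint) (auto simp: Y_def)
    ultimately have "card (F \<inter> (E \<union> Y)) = t - 1 + m" using not_containing_E(2) [OF F False] by simp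
    then show ?thesis using False FD signed_setsD(3) [OF E_Un_Y] t_ge by (simp add: hm_family_def)
  qed
qed

end

section \<open>Numerical comparison\<close>

text \<open>The comparisons after division by \<open>N (t + 1)\<close>: \<open>q\<close> stands for \<open>N (t + 2) / N (t + 1)\<close>, \<open>u\<close> for
  \<open>q\<close> multiplied by \<open>(t + 2) choose 2\<close>, and the benchmarks are \<open>t + 2 - (t + 1) * q\<close> for \<open>v \<le> t + 2\<close>
  and \<open>v - B\<close> for \<open>v \<ge> t + 3\<close>. The lemmas with suffix \<open>small\<close> and \<open>large\<close> concern these two
  ranges.\<close>

locale size_estimates =
  fixes t v q u :: real
  assumes t: "2 \<le> t" and v: "2 \<le> v" and q: "0 \<le> q"
    and u: "u = (t + 2) * (t + 1) / 2 * q" and vu: "(v + 2) * u \<le> 1" and vq: "(v + 2) * v * q \<le> 2"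
begin

lemma u_nonneg: "0 \<le> u" using t q by (simp add: u)

lemma vq_nonneg: "0 \<le> v * q" using v q by simp

lemma u_le: "u \<le> 1 / 4"
proof -
  have "4 * u \<le> (v + 2) * u" using v u_nonneg by (intro mult_right_mono) auto
  then show ?thesis using vu by simp
qed

lemma v2u: "v ^ 2 * u \<le> v - 2 + 4 * u"
proof -
  have "(v - 2) * ((v + 2) * u) \<le> (v - 2) * 1" using v vu by (intro mult_left_mono) auto
  then show ?thesis by (simp add: power2_eq_square algebra_simps)
qed

lemma tq: "(t + 1) * q \<le> u / 2"
proof -
  have "4 * ((t + 1) * q) \<le> (t + 2) * ((t + 1) * q)" using t q by (intro mult_right_mono) auto
  then show ?thesis by (simp add: u)
qed

lemma q6: "q \<le> u / 6"
proof -
  have "3 * q \<le> (t + 1) * q" using t q by (intro mult_right_mono) auto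
  then show ?thesis using tq by simp
qed

lemma vu1: "v * u \<le> 1" using vu u_nonneg by (simp add: algebra_simps)

lemma v2_tq: "v ^ 2 * ((t + 1) * q) \<le> v / 2 - 1 + 2 * u"
proof -
  have "v ^ 2 * ((t + 1) * q) \<le> v ^ 2 * (u / 2)" using tq by (intro mult_left_mono) auto
  moreover have "v ^ 2 * (u / 2) = (v ^ 2 * u) / 2" by simp
  ultimately show ?thesis using v2u by linarith
qed

lemma v2q: "v ^ 2 * q \<le> v / 6 - 1 / 6"
proof -
  have "v ^ 2 * q \<le> v ^ 2 * (u / 6)" using q6 by (intro mult_left_mono) auto
  moreover have "v ^ 2 * (u / 6) = (v ^ 2 * u) / 6" by simp
  ultimately show ?thesis using v2u u_le by linarith
qed

lemma vtq: "v * (t * q) \<le> 1 / 2"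
proof -
  have "v * (t * q) \<le> v * (u / 2)" using tq q v by (intro mult_left_mono) (auto simp: algebra_simps)
  then show ?thesis using vu1 by simp
qed

lemma vq6: "v * q \<le> 1 / 6"
proof -
  have "v * q \<le> v * (u / 6)" using q6 v by (intro mult_left_mono) auto
  then show ?thesis using vu1 by simp
qed

text \<open>The normalised second-order term \<open>(v choose 2) * q\<close> of the lower bound for the large
  family.\<close>

definition B :: real where "B = v * (v - 1) / 2 * q"

lemma B_le: "(v + 2) * B \<le> v - 1"
proof -
  have "(v - 1) * ((v + 2) * v * q) \<le> (v - 1) * 2" using vq v by (intro mult_left_mono) auto
  moreover have "(v - 1) * ((v + 2) * v * q) = 2 * ((v + 2) * B)" by (simp add: B_def)
  ultimately show ?thesis by (simp only:) simp
qed

lemma B_less: "B < 1"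
proof (rule ccontr)
  assume "\<not> B < 1"
  then have "(v + 2) * 1 \<le> (v + 2) * B" using v by (intro mult_left_mono) auto
  then show False using B_le by simp
qed

lemma no_covers_small:
  assumes "v \<le> t + 2"
  shows "(t + 2) * (t + 1) / 2 * (v ^ 2 * q) < t + 2 - (t + 1) * q"
proof -
  have *: "(t + 2) * (t + 1) / 2 * (v ^ 2 * q) = v ^ 2 * u" by (simp add: u)
  show ?thesis unfolding * using v2u u_le tq assms by linarith
qed

lemma no_covers_large:
  assumes "t + 3 \<le> v"
  shows "(t + 2) * (t + 1) / 2 * (v ^ 2 * q) < v - B"
proof -
  have "7 * u \<le> (v + 2) * u" using t assms u_nonneg by (intro mult_right_mono) auto
  then have "u \<le> 1 / 7" using vu by simp
  moreover have *: "(t + 2) * (t + 1) / 2 * (v ^ 2 * q) = v ^ 2 * u" by (simp add: u)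
  ultimately show ?thesis unfolding * using v2u B_less by linarith
qed

lemma one_cover_eq:
  "1 + (v - 1) * (v * q) + t * (v * (v * q)) = 1 + v ^ 2 * ((t + 1) * q) - v * q"
  by (simp add: power2_eq_square algebra_simps)

lemma one_cover_small:
  assumes "v \<le> t + 2"
  shows "1 + (v - 1) * (v * q) + t * (v * (v * q)) < t + 2 - (t + 1) * q"
  unfolding one_cover_eq using assms v2_tq tq u_le t vq_nonneg v by linarith

lemma one_cover_large:
  assumes "t + 3 \<le> v"
  shows "1 + (v - 1) * (v * q) + t * (v * (v * q)) < v - B"
  unfolding one_cover_eq using assms v2_tq u_le t vq_nonneg v B_less by linarith

lemma two_covers_le: "2 + (v - 2) * (v * q) + t * (v * q) \<le> 7 / 3 + v / 6"
proof -
  have "(v - 2) * (v * q) = v ^ 2 * q - 2 * (v * q)" "t * (v * q) = v * (t * q)"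
    by (simp_all add: power2_eq_square algebra_simps)
  then show ?thesis using v2q vtq vq_nonneg v by linarith
qed

lemma two_covers_small:
  assumes "v \<le> t + 2"
  shows "2 + (v - 2) * (v * q) + t * (v * q) < t + 2 - (t + 1) * q"
  by (rule le_less_trans [OF two_covers_le]) (use tq u_le t assms in linarith)

lemma two_covers_large:
  assumes "t + 3 \<le> v"
  shows "2 + (v - 2) * (v * q) + t * (v * q) < v - B"
  by (rule le_less_trans [OF two_covers_le]) (use B_less t assms in linarith)

lemma many_covers_small:
  assumes "v \<le> t + 2" "m \<le> v" "m \<noteq> v \<longrightarrow> m \<le> v - 1" "m \<noteq> v \<or> v \<le> t + 1"
  shows "m + (v - m) * (v * q) + t * q < t + 2 - (t + 1) * q"
proof -
  have "(v - m) * (v * q) \<le> (v - m) * (1 / 6)" using assms vq6 by (intro mult_left_mono) auto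
  moreover have "(v - m) * (1 / 6) = v / 6 - m / 6" by (simp add: field_simps)
  moreover have "t * q + (t + 1) * q \<le> 1 / 4" using tq u_le q by (simp add: algebra_simps)
  moreover have "m \<le> v - 1 \<or> m = v \<and> v \<le> t + 1" using assms by blast
  ultimately show ?thesis using assms(1) by (elim disjE conjE) linarith+
qed

lemma many_covers_large:
  assumes "m \<le> v - 1"
  shows "m + (v - m) * (v * q) + t * q < v - B"
proof -
  have "(v + 2) * (t * q) \<le> (v + 2) * (u / 2)"
    using tq q v by (intro mult_left_mono) (auto simp: algebra_simps)
  then have 1: "(v + 2) * (t * q) \<le> 1 / 2" using vu by simp
  have 2: "(v - m) * ((v + 2) * v * q) \<le> (v - m) * 2" using assms vq by (intro mult_left_mono) auto
  have "1 * v \<le> (v - m) * v" using assms v by (intro mult_right_mono) auto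
  then have "(v + 2) * ((v - m) * (v * q) + t * q + B) < (v + 2) * (v - m)"
    using 1 2 B_le by (simp add: algebra_simps)
  then have "(v - m) * (v * q) + t * q + B < v - m" using v by simp
  then show ?thesis by simp
qed

end

lemma real_choose_two: "real (n choose 2) = real n * (real n - 1) / 2"
proof -
  have "2 * (n choose 2) = n * (n - 1)"
    unfolding choose_two by (rule dvd_mult_div_cancel) (cases n; simp)
  then have "real (2 * (n choose 2)) = real (n * (n - 1))" by (simp only:)
  then show ?thesis by (cases n) (simp_all add: algebra_simps)
qed

context signed_parameters
begin

text \<open>The quotient of the sizes of two consecutive stars; \<open>q = 0\<close> if \<open>r = t + 1\<close>.\<close>

definition q :: real where "q = real (N (t + 2)) / real (N (t + 1))"

lemma N_pos: "0 < N (t + 1)" using r_ge r_le k_ge by (intro star_size_pos) auto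

lemma N_q: "real (N (t + 2)) = q * real (N (t + 1))" using N_pos by (simp add: q_def)

lemma choose_real: "real ((t + 2) choose 2) = (real t + 2) * (real t + 1) / 2"
  using real_choose_two [of "t + 2"] by (simp add: algebra_simps)

sublocale size_estimates "real t" "real v" q "(real t + 2) * (real t + 1) / 2 * q"
proof
  show "2 \<le> real t" "2 \<le> real v" "0 \<le> q" using t_ge v_ge by (simp_all add: q_def)
  have ratio: "real ((v + 2) * ((t + 2) choose 2) * N (t + 2)) \<le> real (N (t + 1))"
    "real ((v + 2) * v * N (t + 2)) \<le> real (2 * N (t + 1))"
    using star_size_ratio [of "t + 1"] by (simp_all only: of_nat_le_iff) simp_all
  have "((real v + 2) * ((real t + 2) * (real t + 1) / 2 * q)) * real (N (t + 1)) \<le> 1 * real (N (t + 1))"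
    using ratio(1) unfolding of_nat_mult choose_real N_q by (simp add: algebra_simps)
  then show "(real v + 2) * ((real t + 2) * (real t + 1) / 2 * q) \<le> 1"
    by (rule mult_right_le_imp_le) (use N_pos in simp)
  have "((real v + 2) * real v * q) * real (N (t + 1)) \<le> 2 * real (N (t + 1))"
    using ratio(2) unfolding of_nat_mult N_q by (simp add: algebra_simps)
  then show "(real v + 2) * real v * q \<le> 2"
    by (rule mult_right_le_imp_le) (use N_pos in simp)
qed (rule refl)

end

section \<open>Structure of the largest families\<close>

context largest_family
begin

lemma card_family_ge_small:
  "(real t + 2 - (real t + 1) * q) * real (N (t + 1)) \<le> real (card \<F>)"
proof -
  have "(t + 2) * N (t + 1) \<le> card \<F> + (t + 1) * N (t + 2)"
    using card_H1_small_ge H1_le_card_family [of "t + 2"] r_ge n_ge by simp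
  then have "real ((t + 2) * N (t + 1)) \<le> real (card \<F> + (t + 1) * N (t + 2))"
    by (simp only: of_nat_le_iff)
  then show ?thesis unfolding of_nat_add of_nat_mult N_q by (simp add: algebra_simps)
qed

lemma v_cases: "t + v \<le> r + 1" "t + v \<le> n" "t + v = min (r + 1) n"
  using r_ge n_ge by (auto simp: v_def)

lemma card_family_ge_large:
  "(real v - B) * real (N (t + 1)) \<le> real (card \<F>)"
proof -
  have "v * N (t + 1) \<le> card \<F> + (v choose 2) * N (t + 2)"
    using card_H1_ge [of "t + v"] H1_le_card_family [of "t + v"] v_ge v_cases(1,2) by simp
  then have "real (v * N (t + 1)) \<le> real (card \<F> + (v choose 2) * N (t + 2))"
    by (simp only: of_nat_le_iff)
  then show ?thesis
    unfolding of_nat_add of_nat_mult N_q real_choose_two by (simp add: B_def algebra_simps)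
qed

lemma size_contradiction:
  assumes "real (card \<F>) \<le> a * real (N (t + 1))" and "b * real (N (t + 1)) \<le> real (card \<F>)" and "a < b"
  shows False
proof -
  have "b * real (N (t + 1)) \<le> a * real (N (t + 1))" using assms(1,2) by simp
  then show False using \<open>a < b\<close> N_pos by simp
qed

text \<open>Both lower bounds hold whatever \<open>v\<close> is, so an upper bound below either of them is
  impossible.\<close>

lemma not_small_upper: "real (card \<F>) \<le> a * real (N (t + 1)) \<Longrightarrow> \<not> a < real t + 2 - (real t + 1) * q"
  using size_contradiction card_family_ge_small by blast

lemma not_large_upper: "real (card \<F>) \<le> a * real (N (t + 1)) \<Longrightarrow> \<not> a < real v - B"
  using size_contradiction card_family_ge_large by blast

lemma covers_nonempty: "covers \<noteq> {}"
proof
  assume "covers = {}"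
  then have "real (card \<F>) \<le> real (((t + 2) choose 2) * (v ^ 2 * N (t + 2)))"
    using card_family_no_covers by (simp only: of_nat_le_iff)
  also have "\<dots> = ((real t + 2) * (real t + 1) / 2 * (real v ^ 2 * q)) * real (N (t + 1))"
    unfolding of_nat_mult of_nat_power choose_real N_q by simp
  finally have *: "real (card \<F>) \<le> \<dots>" .
  have "v \<le> t + 2 \<or> t + 3 \<le> v" by linarith
  then show False
  proof
    assume "v \<le> t + 2"
    then show False using not_small_upper [OF *] no_covers_small by simp
  next
    assume "t + 3 \<le> v"
    then show False using not_large_upper [OF *] no_covers_large by simp
  qed
qed

lemma triangle_case:
  assumes Z: "Z \<in> signed_sets n (t + 2) k" "\<And>F. F \<in> \<F> \<Longrightarrow> t + 1 \<le> card (F \<inter> Z)"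
  shows "v \<le> t + 2 \<and> family_iso n k \<F> (H1 n r k (t + 2) t)"
proof
  show "v \<le> t + 2"
  proof (rule ccontr)
    assume "\<not> v \<le> t + 2"
    have "real (card \<F>) \<le> real ((t + 2) * N (t + 1))"
      using card_family_triangle [OF Z] by (simp only: of_nat_le_iff)
    then have "real (card \<F>) \<le> (real t + 2) * real (N (t + 1))" by (simp add: algebra_simps)
    then have "\<not> real t + 2 < real v - B" by (rule not_large_upper)
    then show False using B_less \<open>\<not> v \<le> t + 2\<close> by linarith
  qed
  obtain E where E: "E \<subseteq> Z" "card E = t"
    using obtain_subset_with_card_n [of t Z] signed_setsD(3) [OF Z(1)] by auto
  show "family_iso n k \<F> (H1 n r k (t + 2) t)"
    using r_ge n_ge triangle_subset_hm_family [OF Z E(1)]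
    by (intro family_iso_H1 [OF _ _ _ Z(1) E]) auto
qed

end

context star_of_covers
begin

lemma card_family_bound:
  assumes "card {F \<in> \<F>. \<not> E \<subseteq> F} \<le> x"
  shows "card \<F> \<le> m * N (t + 1) + (v - m) * (v * N (t + 2)) + x"
  using card_family_split card_E_and_Y card_E_not_Y assms by linarith

lemma real_card_family_bound:
  assumes "card {F \<in> \<F>. \<not> E \<subseteq> F} \<le> x" "real x = y * real (N (t + 1))"
  shows "real (card \<F>) \<le> (real m + (real v - real m) * (real v * q) + y) * real (N (t + 1))"
proof -
  have "real (card \<F>) \<le> real (m * N (t + 1) + (v - m) * (v * N (t + 2)) + x)"
    using card_family_bound [OF assms(1)] by (simp only: of_nat_le_iff)
  also have "\<dots> = (real m + (real v - real m) * (real v * q) + y) * real (N (t + 1))"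
    unfolding of_nat_add of_nat_mult N_q assms(2) of_nat_diff [OF m_le] by (simp add: algebra_simps)
  finally show ?thesis .
qed

lemma m_ge_3: "3 \<le> m"
proof (rule ccontr)
  assume "\<not> 3 \<le> m"
  then consider "m = 1" | "m = 2" using m_ge by linarith
  moreover have dich: "v \<le> t + 2 \<or> t + 3 \<le> v" by linarith
  ultimately show False
  proof cases
    case 1
    have "real (card \<F>) \<le> (real m + (real v - real m) * (real v * q)
        + real t * (real v * (real v * q))) * real (N (t + 1))"
      by (rule real_card_family_bound [OF card_not_E_1 [OF 1]]) (simp only: of_nat_mult N_q mult.assoc)
    then show False
      using not_small_upper not_large_upper one_cover_small one_cover_large dich 1 by fastforce
  next
    case 2
    have "real (card \<F>) \<le> (real m + (real v - real m) * (real v * q)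
        + real t * (real v * q)) * real (N (t + 1))"
      by (rule real_card_family_bound [OF card_not_E_2 [OF 2]]) (simp only: of_nat_mult N_q mult.assoc)
    then show False
      using not_small_upper not_large_upper two_covers_small two_covers_large dich 2 by fastforce
  qed
qed

lemma real_card_family_bound_3:
  "real (card \<F>) \<le> (real m + (real v - real m) * (real v * q) + real t * q) * real (N (t + 1))"
proof (rule real_card_family_bound)
  have "N (t - 1 + m) \<le> N (t + 2)" using m_ge_3 t_ge by (intro star_size_antimono) simp
  then show "card {F \<in> \<F>. \<not> E \<subseteq> F} \<le> t * N (t + 2)"
    using card_not_E by (meson le_trans mult_le_mono2)
qed (simp only: of_nat_mult N_q mult.assoc)

lemma m_eq_v: "m = v"
proof (rule ccontr)
  assume "m \<noteq> v"
  then have m: "real m \<le> real v - 1" using m_le by linarith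
  have "v \<le> t + 2 \<or> t + 3 \<le> v" by linarith
  then show False
  proof
    assume "v \<le> t + 2"
    then have "real m + (real v - real m) * (real v * q) + real t * q < real t + 2 - (real t + 1) * q"
      using m by (intro many_covers_small) auto
    then show False using not_small_upper [OF real_card_family_bound_3] by simp
  next
    assume "t + 3 \<le> v"
    then show False using not_large_upper [OF real_card_family_bound_3] many_covers_large [OF m] by simp
  qed
qed

text \<open>With \<open>m = v\<close>, first-order terms exclude \<open>v \<le> t + 1\<close>. For \<open>v = t + 2\<close> they cancel, and what
  remains is \<open>N (t + 2) \<le> 2 * N (t + 3)\<close>, contrary to \<open>star_size_ratio\<close>.\<close>

lemma v_gt: "t + 2 < v"
proof (rule ccontr)
  assume "\<not> t + 2 < v"
  then have le: "v \<le> t + 2" by simp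
  have "v = t + 2"
  proof (rule ccontr)
    assume "v \<noteq> t + 2"
    then have "real m + (real v - real m) * (real v * q) + real t * q < real t + 2 - (real t + 1) * q"
      using m_eq_v le by (intro many_covers_small) auto
    then show False using not_small_upper [OF real_card_family_bound_3] by simp
  qed
  then have m: "m = t + 2" using m_eq_v by simp
  let ?P = "card {F \<in> \<F>. E \<subseteq> F \<and> Y \<inter> F \<noteq> {}}"
  have "?P + N (t + 2) + t * (2 * N (t + 2)) \<le> (t + 2) * N (t + 1) + t * N (t + 3)"
    using card_E_and_Y_refined unfolding m by simp
  moreover have "card {F \<in> \<F>. E \<subseteq> F \<and> Y \<inter> F = {}} = 0" using card_E_not_Y m_eq_v by simp
  moreover have "card {F \<in> \<F>. \<not> E \<subseteq> F} \<le> t * N (t + 3)"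
  proof -
    have "N (t - 1 + m) \<le> N (t + 3)" using m t_ge by (intro star_size_antimono) simp
    then show ?thesis using card_not_E by (meson le_trans mult_le_mono2)
  qed
  moreover have "(t + 2) * N (t + 1) \<le> card \<F> + (t + 1) * N (t + 2)"
    using card_H1_small_ge H1_le_card_family [of "t + 2"] r_ge n_ge by simp
  ultimately have "t * (2 * N (t + 2)) \<le> t * N (t + 2) + t * (2 * N (t + 3))"
    using card_family_split unfolding add_mult_distrib mult.left_commute [of t 2] by linarith
  then have "t * N (t + 2) \<le> t * (2 * N (t + 3))" by simp
  then have "N (t + 2) \<le> 2 * N (t + 3)" using t_ge by simp
  moreover have "(v + 2) * ((t + 2) choose 2) * N (t + 3) \<le> N (t + 2)"
    using star_size_ratio(1) [of "t + 2"] by (simp add: eval_nat_numeral)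
  moreover have "4 * N (t + 3) \<le> (v + 2) * ((t + 2) choose 2) * N (t + 3)"
  proof -
    have "0 < (t + 2) choose 2" by (rule zero_less_binomial) simp
    then have "4 * 1 \<le> (v + 2) * ((t + 2) choose 2)"
      using v_ge by (intro mult_le_mono) linarith+
    then show ?thesis by (intro mult_le_mono1) simp
  qed
  moreover have "0 < N (t + 2)"
    using \<open>v = t + 2\<close> v_cases r_le t_ge k_ge by (intro star_size_pos) auto
  ultimately show False by linarith
qed

lemma star_case: "t + 2 < v \<and> family_iso n k \<F> (H1 n r k (t + v) t)"
proof
  show "t + 2 < v" by (rule v_gt)
  show "family_iso n k \<F> (H1 n r k (t + v) t)"
    using v_ge v_cases E_Un_Y ED(3) m_eq_v star_subset_hm_family [OF m_eq_v]
    by (intro family_iso_H1 [of _ "E \<union> Y" E]) auto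
qed

end

theorem theorem1p2:
  fixes n r k t :: nat and \<F> :: "(nat \<times> nat) set set"
  assumes "n > 0" and "r > 0" and "k > 0" and "t > 0"
    and "n \<ge> t + 2" and "t + 2 \<ge> 4"
    and "n \<ge> r" and "r \<ge> t + 1"
    and "real k \<ge> max 2 (g n r t)"
    and "largest_nontrivial_t_intersecting n r k t \<F>"
  shows "(min (r + 1) n \<le> 2 * t + 2 \<longrightarrow> family_iso n k \<F> (H1 n r k (t + 2) t)) \<and>
         (min (r + 1) n > 2 * t + 2 \<longrightarrow> family_iso n k \<F> (H1 n r k (min (r + 1) n) t))"
proof -
  interpret largest_family n r k t \<F>
    using assms by unfold_locales auto
  have v: "min (r + 1) n = t + v" using v_cases(3) by simp
  show ?thesis
  proof (cases "\<exists>T1\<in>covers. \<exists>T2\<in>covers. \<exists>T3\<in>covers. T1 \<noteq> T2 \<and> \<not> T1 \<inter> T2 \<subseteq> T3")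
    case True
    then obtain Z where "Z \<in> signed_sets n (t + 2) k" "\<And>F. F \<in> \<F> \<Longrightarrow> t + 1 \<le> card (F \<inter> Z)"
      using covers_triangle by blast
    then have "v \<le> t + 2 \<and> family_iso n k \<F> (H1 n r k (t + 2) t)" by (rule triangle_case)
    then show ?thesis unfolding v by auto
  next
    case False
    then obtain E where "E \<in> signed_sets n t k" "\<forall>T\<in>covers. E \<subseteq> T"
      using covers_star [OF covers_nonempty] by blast
    then interpret star_of_covers n r k t \<F> E
      using covers_nonempty by unfold_locales auto
    show ?thesis using star_case unfolding v by auto
  qed
qed

end
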